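(* Let \(G\) be a finite, simple, connected graph with maximum degree \(\Delta(G)\leq 4\), and suppose \(G\) is not (isomorphic to) the graph of the octahedron. Then \(G\) is convergent, i.e. there exist integers \(0\le m<n\) such that \(K^{m}(G)\cong K^{n}(G)\).
   Context: All graphs are finite and simple. A clique of a graph is a maximal complete subgraph. The clique graph \(K(G)\) is the intersection graph of the cliques of \(G\) (vertices are the cliques of \(G\), two adjacent iff they share a vertex). Iterated clique graphs: \(K^{0}(G)=G\), \(K^{n}(G)=K(K^{n-1}(G))\). \(G\) is convergent if there are \(m<n\) with \(K^{m}(G)\cong K^{n}(G)\) (equivalently, the iterated clique graphs take only finitely many isomorphism types), and divergent otherwise. The octahedron is the complete tripartite graph \(K_{2,2,2}\) (6 vertices, 4-regular). *)

theory Defs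
  imports "Graph_Theory.Graph_Theory" "HOL-Library.FSet"
begin

text \<open>
  Finite simple graphs are the symmetric loop-free digraphs of the locale \<open>pair_graph\<close>:
  an edge is a pair of opposite arcs, so the degree of a vertex is its out-degree.
\<close>

definition max_degree :: "'a pair_pre_digraph \<Rightarrow> nat" where
  "max_degree G = Max (out_degree (with_proj G) ` pverts G)"

definition octahedron :: "(nat \<times> nat) pair_pre_digraph" where
  "octahedron = \<lparr> pverts = {..<3} \<times> {..<2},
     parcs = {(u, v). u \<in> {..<3} \<times> {..<2} \<and> v \<in> {..<3} \<times> {..<2} \<and> fst u \<noteq> fst v} \<rparr>"

definition complete_graph :: "('a, 'b) pre_digraph \<Rightarrow> bool" where
  "complete_graph H \<longleftrightarrow> (\<exists>n>0. complete_digraph n H)"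

text \<open>A clique, being a complete subgraph, is represented by its vertex set.\<close>

definition cliques :: "'a pair_pre_digraph \<Rightarrow> 'a set set" where
  "cliques G = verts ` {H. pre_digraph.max_subgraph (with_proj G) complete_graph H}"

definition clique_graph :: "'a pair_pre_digraph \<Rightarrow> 'a set pair_pre_digraph" where
  "clique_graph G = \<lparr> pverts = cliques G,
     parcs = {(S, T). S \<in> cliques G \<and> T \<in> cliques G \<and> S \<noteq> T \<and> S \<inter> T \<noteq> {}} \<rparr>"

text \<open>
  Since \<open>clique_graph\<close> changes the vertex type from \<open>'a\<close> to \<open>'a set\<close>, it cannot be
  iterated directly. The type below contains the vertices of all the iterates at once: those of
  \<open>G\<close> itself, and the finite sets of vertices introduced earlier. The relabelling maps
  are injective on the relevant vertices, so only names of vertices change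
  (\<open>iterated_clique_graph_0_iso\<close>, \<open>iterated_clique_graph_Suc_iso\<close>).
\<close>

datatype 'a clique_vertex = Base 'a | Clique "'a clique_vertex fset"

definition relabel :: "('a \<Rightarrow> 'b) \<Rightarrow> 'a pair_pre_digraph \<Rightarrow> 'b pair_pre_digraph" where
  "relabel f G = \<lparr> pverts = f ` pverts G, parcs = map_prod f f ` parcs G \<rparr>"

primrec iterated_clique_graph ::
    "nat \<Rightarrow> 'a pair_pre_digraph \<Rightarrow> 'a clique_vertex pair_pre_digraph" where
  "iterated_clique_graph 0 G = relabel Base G"
| "iterated_clique_graph (Suc n) G =
     relabel (\<lambda>S. Clique (Abs_fset S)) (clique_graph (iterated_clique_graph n G))"

definition convergent_graph :: "'a pair_pre_digraph \<Rightarrow> bool" where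
  "convergent_graph G \<longleftrightarrow> (\<exists>m n. m < n \<and>
     digraph_iso (with_proj (iterated_clique_graph m G)) (with_proj (iterated_clique_graph n G)))"

lemma relabel_iso:
  assumes wf: "pair_wf_digraph G" and inj: "inj_on f (pverts G)"
  shows "digraph_iso (with_proj G) (with_proj (relabel f G))"
proof -
  interpret pair_wf_digraph G by (rule wf)
  let ?h = "\<lparr> iso_verts = f, iso_arcs = map_prod f f, iso_head = snd, iso_tail = fst \<rparr>"
  have sub: "parcs G \<subseteq> pverts G \<times> pverts G"
    using in_arcsD1 in_arcsD2 by auto
  have "inj_on (map_prod f f) (parcs G)"
    using map_prod_inj_on[OF inj inj] sub by (rule inj_on_subset)
  then have "pre_digraph.digraph_isomorphism (with_proj G) ?h"
    using inj wf_digraph by (auto simp: pre_digraph.digraph_isomorphism_def)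
  moreover have "with_proj (relabel f G) = app_iso ?h (with_proj G)"
    by (simp add: with_proj_def relabel_def app_iso_def)
  ultimately show ?thesis unfolding digraph_iso_def by blast
qed

lemma finite_clique: "S \<in> cliques G \<Longrightarrow> finite S"
  by (auto simp: cliques_def pre_digraph.max_subgraph_def complete_graph_def
      complete_digraph_def dest: graph.axioms digraph.axioms fin_digraph.finite_verts)

lemma wf_clique_graph: "pair_wf_digraph (clique_graph G)"
  by unfold_locales (auto simp: clique_graph_def)

lemma iterated_clique_graph_0_iso:
  "pair_graph G \<Longrightarrow> digraph_iso (with_proj G) (with_proj (iterated_clique_graph 0 G))"
  by (auto intro!: relabel_iso inj_onI
      simp: pair_graph_def pair_digraph_def pair_fin_digraph_def)

lemma iterated_clique_graph_Suc_iso: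
  "digraph_iso (with_proj (clique_graph (iterated_clique_graph n G)))
     (with_proj (iterated_clique_graph (Suc n) G))"
  unfolding iterated_clique_graph.simps
  by (rule relabel_iso[OF wf_clique_graph])
    (auto intro!: inj_onI simp: clique_graph_def Abs_fset_inject finite_clique)

lemma cliques_conv:
  assumes "pair_wf_digraph G"
  shows "S \<in> cliques G \<longleftrightarrow> S \<noteq> {} \<and> finite S \<and> S \<subseteq> pverts G \<and>
     (\<forall>u\<in>S. \<forall>v\<in>S. u \<noteq> v \<longrightarrow> (u, v) \<in> parcs G) \<and>
     (\<forall>T. finite T \<and> S \<subset> T \<and> T \<subseteq> pverts G \<longrightarrow>
        (\<exists>u\<in>T. \<exists>v\<in>T. u \<noteq> v \<and> (u, v) \<notin> parcs G))" (is "_ \<longleftrightarrow> ?R S")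
proof -
  interpret pair_wf_digraph G by (rule assms)
  define C where "C T = \<lparr> pverts = T, parcs = {(u, v). u \<in> T \<and> v \<in> T \<and> u \<noteq> v} \<rparr>" for T :: "'a set"
  have wfC: "wf_digraph (with_proj (C T))" for T
    by unfold_locales (auto simp: C_def)
  have complC: "complete_graph (with_proj (C T)) \<longleftrightarrow> T \<noteq> {} \<and> finite T" for T
    by (auto simp: complete_graph_def complete_digraph_pair_def C_def card_gt_0_iff)
  have subC: "subgraph (with_proj (C T)) (with_proj G) \<longleftrightarrow>
      T \<subseteq> pverts G \<and> (\<forall>u\<in>T. \<forall>v\<in>T. u \<noteq> v \<longrightarrow> (u, v) \<in> parcs G)" for T
    using wfC[of T] wf_digraph by (auto simp: subgraph_def C_def compatible_def)
  have subCC: "subgraph (with_proj (C T)) (with_proj (C U)) \<longleftrightarrow> T \<subseteq> U" for T U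
    using wfC[of T] wfC[of U] by (auto simp: subgraph_def C_def compatible_def)
  have eqC: "with_proj (C T) = with_proj (C U) \<longleftrightarrow> T = U" for T U
    by (auto simp: with_proj_def C_def)
  have form: "H = with_proj (C (verts H))"
    if "subgraph H (with_proj G)" "complete_graph H" for H
  proof -
    have th: "tail H = fst" "head H = snd"
      using that(1) by (auto simp: subgraph_def compatible_def)
    then have "arcs_ends H = arcs H" by (auto simp: arcs_ends_conv)
    with that(2) have "arcs H = {(u, v). u \<in> verts H \<and> v \<in> verts H \<and> u \<noteq> v}"
      by (auto simp: complete_graph_def complete_digraph_def)
    with th show ?thesis by (simp add: with_proj_def C_def)
  qed
  have key: "pre_digraph.max_subgraph (with_proj G) complete_graph (with_proj (C T)) \<longleftrightarrow> ?R T" for T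
  proof -
    have "(\<forall>H'. H' \<noteq> with_proj (C T) \<and> subgraph (with_proj (C T)) H' \<longrightarrow>
        \<not> (subgraph H' (with_proj G) \<and> complete_graph H')) \<longleftrightarrow>
      (\<forall>U. U \<noteq> T \<and> T \<subseteq> U \<longrightarrow>
        \<not> (subgraph (with_proj (C U)) (with_proj G) \<and> U \<noteq> {} \<and> finite U))"
      (is "?A \<longleftrightarrow> ?B")
    proof
      assume ?A then show ?B using eqC subCC complC by blast
    next
      assume B: ?B
      show ?A
      proof (intro allI impI notI)
        fix H' assume 1: "H' \<noteq> with_proj (C T) \<and> subgraph (with_proj (C T)) H'"
          and 2: "subgraph H' (with_proj G) \<and> complete_graph H'"
        then obtain U where U: "H' = with_proj (C U)" using form by blast
        from 1 have "U \<noteq> T" "T \<subseteq> U" by (simp_all add: U eqC subCC)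
        moreover from 2 have "subgraph (with_proj (C U)) (with_proj G)" "U \<noteq> {}" "finite U"
          by (simp_all add: U complC)
        ultimately show False using B[rule_format, of U] by simp
      qed
    qed
    then have "pre_digraph.max_subgraph (with_proj G) complete_graph (with_proj (C T)) \<longleftrightarrow>
        subgraph (with_proj (C T)) (with_proj G) \<and> (T \<noteq> {} \<and> finite T) \<and> ?B"
      by (simp only: pre_digraph.max_subgraph_def complC)
    then show ?thesis by (auto simp: subC psubset_eq)
  qed
  have vC: "verts (with_proj (C T)) = T" for T by (simp add: C_def)
  have "S \<in> cliques G \<longleftrightarrow>
      pre_digraph.max_subgraph (with_proj G) complete_graph (with_proj (C S))"
  proof
    assume "S \<in> cliques G"
    then obtain H where H: "S = verts H" "pre_digraph.max_subgraph (with_proj G) complete_graph H"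
      by (auto simp: cliques_def)
    then have "H = with_proj (C S)" using form[of H] by (auto simp: pre_digraph.max_subgraph_def)
    with H(2) show "pre_digraph.max_subgraph (with_proj G) complete_graph (with_proj (C S))"
      by (rule subst[rotated])
  next
    assume "pre_digraph.max_subgraph (with_proj G) complete_graph (with_proj (C S))"
    then show "S \<in> cliques G" unfolding cliques_def 
      by (intro image_eqI[where x = "with_proj (C S)"] CollectI) (simp_all only: vC)
  qed
  then show ?thesis unfolding key .
qed

end

theory Submission
  imports Defs
begin

text \<open>
  A graph is clique-Helly if every pairwise intersecting family of its cliques has a common vertex.
  If \<open>J\<close> is clique-Helly then every clique of \<open>K(J)\<close> is the set of all
  cliques of \<open>J\<close> through some vertex; hence \<open>K(J)\<close> is again clique-Helly and
  \<open>K\<^sup>2(J)\<close> has at most as many vertices as \<open>J\<close>, so \<open>J\<close> is convergent. It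
  therefore suffices that \<open>K\<^sup>2(G)\<close> is clique-Helly.

  With maximum degree four, the Helly property can fail in \<open>G\<close> only around a triangle
  \<open>T = abc\<close> each of whose edges lies in a second triangle: \<open>bcx\<close>,
  \<open>acy\<close>, \<open>abz\<close>, where \<open>x\<close>, \<open>y\<close>, \<open>z\<close> are not
  adjacent to \<open>a\<close>, \<open>b\<close>, \<open>c\<close> respectively. Then \<open>a\<close>,
  \<open>b\<close>, \<open>c\<close> have no further neighbours, and \<open>x\<close>, \<open>y\<close>,
  \<open>z\<close> are not pairwise adjacent because \<open>G\<close> is not the octahedron. The vertices
  of \<open>K\<^sup>2(G)\<close> are of two kinds: the cliques through a vertex, and the cliques
  meeting such a triangle \<open>T\<close> in two vertices. The point of the second kind given by
  \<open>T\<close> dominates those of the first kind given by \<open>a\<close>, \<open>b\<close>,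
  \<open>c\<close>. So in checking the Helly property through triangles of
  \<open>K\<^sup>2(G)\<close> only vertices outside all these \<open>T\<close> and the \<open>T\<close>
  themselves matter, which leaves few configurations.
\<close>

section \<open>Clique-Helly graphs\<close>

text \<open>
  Graphs are given here by a vertex set \<open>V\<close> and a \<^emph>\<open>reflexive\<close> adjacency
  \<open>R\<close>, so that the clique graph of \<open>(V, R)\<close> is \<open>(maxcl V R, meets)\<close>.
\<close>

definition maxcl :: "'a set \<Rightarrow> ('a \<Rightarrow> 'a \<Rightarrow> bool) \<Rightarrow> 'a set set" where
  "maxcl V R = {S. S \<noteq> {} \<and> S \<subseteq> V \<and> (\<forall>x\<in>S. \<forall>y\<in>S. R x y) \<and>
     (\<forall>v\<in>V. (\<forall>x\<in>S. R v x) \<longrightarrow> v \<in> S)}"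

definition meets :: "'a set \<Rightarrow> 'a set \<Rightarrow> bool" where
  "meets S T \<longleftrightarrow> S \<inter> T \<noteq> {}"

definition clique_Helly :: "'a set \<Rightarrow> ('a \<Rightarrow> 'a \<Rightarrow> bool) \<Rightarrow> bool" where
  "clique_Helly V R \<longleftrightarrow> (\<forall>F. F \<noteq> {} \<and> F \<subseteq> maxcl V R \<and> (\<forall>S\<in>F. \<forall>T\<in>F. meets S T) \<longrightarrow> \<Inter>F \<noteq> {})"

lemma maxcl_cong:
  assumes "\<And>x y. x \<in> V \<Longrightarrow> y \<in> V \<Longrightarrow> R x y \<longleftrightarrow> R' x y"
  shows "maxcl V R = maxcl V R'"
proof -
  have "S \<in> maxcl V R \<longleftrightarrow> S \<in> maxcl V R'" for S
  proof (cases "S \<subseteq> V")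
    case True
    then have "(\<forall>x\<in>S. \<forall>y\<in>S. R x y) \<longleftrightarrow> (\<forall>x\<in>S. \<forall>y\<in>S. R' x y)"
      "(\<forall>v\<in>V. (\<forall>x\<in>S. R v x) \<longrightarrow> v \<in> S) \<longleftrightarrow> (\<forall>v\<in>V. (\<forall>x\<in>S. R' v x) \<longrightarrow> v \<in> S)"
      using assms by (meson subsetD)+
    then show ?thesis by (simp add: maxcl_def)
  qed (simp add: maxcl_def)
  then show ?thesis by blast
qed

lemma maxclD:
  assumes "S \<in> maxcl V R"
  shows "S \<noteq> {}" "S \<subseteq> V" "x \<in> S \<Longrightarrow> y \<in> S \<Longrightarrow> R x y"
    "v \<in> V \<Longrightarrow> (\<And>x. x \<in> S \<Longrightarrow> R v x) \<Longrightarrow> v \<in> S"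
  using assms by (auto simp: maxcl_def)

lemma finite_maxcl: "finite V \<Longrightarrow> finite (maxcl V R)"
  by (rule finite_subset[of _ "Pow V"]) (auto simp: maxcl_def)

lemma complete_extends_to_maxcl:
  assumes "finite V" and refl: "\<And>x. x \<in> V \<Longrightarrow> R x x"
    and sym: "\<And>x y. x \<in> V \<Longrightarrow> y \<in> V \<Longrightarrow> R x y \<Longrightarrow> R y x"
    and S: "S \<noteq> {}" "S \<subseteq> V" "\<And>x y. x \<in> S \<Longrightarrow> y \<in> S \<Longrightarrow> R x y"
  obtains Q where "Q \<in> maxcl V R" "S \<subseteq> Q"
proof -
  let ?A = "{Q. S \<subseteq> Q \<and> Q \<subseteq> V \<and> (\<forall>x\<in>Q. \<forall>y\<in>Q. R x y)}"
  have "finite ?A" by (rule finite_subset[of _ "Pow V"]) (use assms(1) in auto)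
  moreover have "?A \<noteq> {}" using S by auto
  ultimately have "\<exists>Q\<in>?A. \<forall>Q'\<in>?A. Q \<subseteq> Q' \<longrightarrow> Q = Q'" by (rule finite_has_maximal)
  then obtain Q where Q: "Q \<in> ?A" "\<forall>Q'\<in>?A. Q \<subseteq> Q' \<longrightarrow> Q = Q'" by (rule bexE)
  have "v \<in> Q" if v: "v \<in> V" "\<forall>x\<in>Q. R v x" for v
  proof -
    have "R x v" if "x \<in> Q" for x using sym[of v x] v that Q(1) by blast
    then have "insert v Q \<in> ?A" using v Q(1) refl by auto
    then show ?thesis using bspec[OF Q(2), of "insert v Q"] by blast
  qed
  then have "Q \<in> maxcl V R" using Q(1) S(1) by (auto simp: maxcl_def)
  then show thesis using that Q(1) by auto
qed

text \<open>
  A minimal subfamily with empty intersection has at least three members, and picking for three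
  of them a point common to all the others gives the triangle.
\<close>

lemma intersecting_maxcl_cases:
  assumes "finite F" "F \<noteq> {}" and F: "F \<subseteq> maxcl V R"
    and meet: "\<And>S T. S \<in> F \<Longrightarrow> T \<in> F \<Longrightarrow> meets S T"
  obtains v where "v \<in> \<Inter>F"
  | F' a b c where "F' \<subseteq> F" "\<Inter>F' = {}" "F' \<noteq> {}" "R a b" "R b c" "R a c" "a \<in> V" "b \<in> V" "c \<in> V"
      "\<And>Q. Q \<in> F' \<Longrightarrow> a \<in> Q \<and> b \<in> Q \<or> b \<in> Q \<and> c \<in> Q \<or> a \<in> Q \<and> c \<in> Q"
proof (cases "\<Inter>F = {}")
  case True
  let ?A = "{F'. F' \<subseteq> F \<and> \<Inter>F' = {}}"
  have "finite ?A" by (rule finite_subset[of _ "Pow F"]) (use assms(1) in auto)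
  moreover have "?A \<noteq> {}" using True by auto
  ultimately have "\<exists>M\<in>?A. \<forall>M'\<in>?A. M' \<subseteq> M \<longrightarrow> M = M'" by (rule finite_has_minimal)
  then obtain M where M: "M \<in> ?A" "\<forall>M'\<in>?A. M' \<subseteq> M \<longrightarrow> M = M'" by (rule bexE)
  have ne: "M \<noteq> {}" using M(1) by auto
  have pick: "\<exists>v. \<forall>Q\<in>M. Q \<noteq> P \<longrightarrow> v \<in> Q" if "P \<in> M" for P
  proof -
    have "M - {P} \<notin> ?A" using bspec[OF M(2), of "M - {P}"] that by blast
    then have "\<Inter>(M - {P}) \<noteq> {}" using M(1) by auto
    then show ?thesis by auto
  qed
  obtain P1 where P1: "P1 \<in> M" using ne by blast
  \<comment> \<open>A clique is nonempty and any two members of \<open>F\<close> meet, so neither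
    one nor two of them can have empty intersection.\<close>
  have "P1 \<noteq> {}" using P1 M(1) F maxclD(1) by blast
  then obtain P2 where P2: "P2 \<in> M" "P2 \<noteq> P1" using P1 M(1) by (metis (mono_tags, lifting) InterI empty_iff equals0I mem_Collect_eq)
  have "P1 \<inter> P2 \<noteq> {}" using meet[of P1 P2] P1 P2 M(1) by (auto simp: meets_def)
  then obtain P3 where P3: "P3 \<in> M" "P3 \<noteq> P1" "P3 \<noteq> P2"
    using P1 P2 M(1) by (metis (mono_tags, lifting) InterI IntE empty_iff equals0I mem_Collect_eq)
  obtain a where a: "\<forall>Q\<in>M. Q \<noteq> P1 \<longrightarrow> a \<in> Q" using pick[OF P1] by blast
  obtain b where b: "\<forall>Q\<in>M. Q \<noteq> P2 \<longrightarrow> b \<in> Q" using pick[OF P2(1)] by blast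
  obtain c where c: "\<forall>Q\<in>M. Q \<noteq> P3 \<longrightarrow> c \<in> Q" using pick[OF P3(1)] by blast
  have mem: "a \<in> P3" "b \<in> P3" "b \<in> P1" "c \<in> P1" "a \<in> P2" "c \<in> P2"
    using a b c P1 P2 P3 by auto
  have cl: "P1 \<in> maxcl V R" "P2 \<in> maxcl V R" "P3 \<in> maxcl V R" using P1 P2 P3 M(1) F by auto
  show ?thesis
  proof (rule that(2)[of M a b c])
    show "R a b" "R b c" "R a c" using mem maxclD(3)[OF cl(1)] maxclD(3)[OF cl(2)] maxclD(3)[OF cl(3)] by auto
    show "a \<in> V" "b \<in> V" "c \<in> V" using mem maxclD(2)[OF cl(1)] maxclD(2)[OF cl(2)] by auto
    \<comment> \<open>\<open>Q\<close> differs from at least two of \<open>P1\<close>,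
      \<open>P2\<close>, \<open>P3\<close>, and each difference puts the corresponding one of
      \<open>a\<close>, \<open>b\<close>, \<open>c\<close> into \<open>Q\<close>.\<close>
    show "a \<in> Q \<and> b \<in> Q \<or> b \<in> Q \<and> c \<in> Q \<or> a \<in> Q \<and> c \<in> Q" if "Q \<in> M" for Q
      using a b c that P2 P3 by metis
  qed (use M(1) ne in auto)
qed (use that(1) in auto)

text \<open>For a triangle \<open>x\<close>, \<open>y\<close>, \<open>z\<close>, the vertices
  \<open>w\<close> in question form its extended triangle, as in the Dragan-Szwarcfiter
  characterisation of clique-Helly graphs. For reflexive \<open>R\<close> they include the triangle
  itself.\<close>

definition extended_triangle_dominated :: "'a set \<Rightarrow> ('a \<Rightarrow> 'a \<Rightarrow> bool) \<Rightarrow> 'a \<Rightarrow> 'a \<Rightarrow> 'a \<Rightarrow> bool" where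
  "extended_triangle_dominated V R x y z \<longleftrightarrow>
     (\<exists>u\<in>V. \<forall>w\<in>V. R w x \<and> R w y \<or> R w y \<and> R w z \<or> R w x \<and> R w z \<longrightarrow> R w u)"

text \<open>In a pairwise meeting family without common vertex, some subfamily \<open>F'\<close>
  with empty intersection has all its members sharing two vertices with one triangle. A vertex
  \<open>u\<close> dominating the extended triangle is related to every vertex of each member, so by
  maximality it lies in all of them, a contradiction.\<close>

lemma clique_Helly_triangles:
  assumes "finite V" and sym: "\<And>x y. x \<in> V \<Longrightarrow> y \<in> V \<Longrightarrow> R x y \<Longrightarrow> R y x"
    and tri: "\<And>x y z. x \<in> V \<Longrightarrow> y \<in> V \<Longrightarrow> z \<in> V \<Longrightarrow> R x y \<Longrightarrow> R y z \<Longrightarrow> R x z \<Longrightarrow>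
      extended_triangle_dominated V R x y z"
  shows "clique_Helly V R"
  unfolding clique_Helly_def
proof (intro allI impI)
  fix F assume F: "F \<noteq> {} \<and> F \<subseteq> maxcl V R \<and> (\<forall>S\<in>F. \<forall>T\<in>F. meets S T)"
  then have "finite F" using finite_maxcl[OF assms(1)] finite_subset by blast
  then show "\<Inter>F \<noteq> {}"
  proof (rule intersecting_maxcl_cases[of F V R])
    fix F' a b c
    assume F': "F' \<subseteq> F" "\<Inter>F' = {}" "F' \<noteq> {}" and abc: "R a b" "R b c" "R a c" "a \<in> V" "b \<in> V" "c \<in> V"
      and two: "\<And>Q. Q \<in> F' \<Longrightarrow> a \<in> Q \<and> b \<in> Q \<or> b \<in> Q \<and> c \<in> Q \<or> a \<in> Q \<and> c \<in> Q"
    obtain u where u: "u \<in> V" "\<And>w. w \<in> V \<Longrightarrow> R w a \<and> R w b \<or> R w b \<and> R w c \<or> R w a \<and> R w c \<Longrightarrow> R w u"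
      using tri[of a b c] abc unfolding extended_triangle_dominated_def by blast
    have "u \<in> Q" if Q: "Q \<in> F'" for Q
    proof -
      have cl: "Q \<in> maxcl V R" using Q F' F by auto
      show ?thesis
      proof (rule maxclD(4)[OF cl u(1)])
        fix w assume w: "w \<in> Q"
        then have "R w u" using u(2)[of w] two[OF Q] maxclD(2,3)[OF cl] by blast
        then show "R u w" using sym[of w u] u(1) w maxclD(2)[OF cl] by blast
      qed
    qed
    then show ?thesis using F' by blast
  qed (use F in auto)
qed

text \<open>The Helly property gives a vertex \<open>v\<close> common to all members. Every clique
  through \<open>v\<close> then meets all of them, and maximality of the family takes it in.\<close>

lemma maxcl_meets_of_clique_Helly:
  assumes "clique_Helly V R" and \<Q>: "\<Q> \<in> maxcl (maxcl V R) meets"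
  obtains v where "v \<in> V" "\<Q> = {Q \<in> maxcl V R. v \<in> Q}"
proof -
  have "\<Inter>\<Q> \<noteq> {}"
    using assms(1) maxclD[OF \<Q>] unfolding clique_Helly_def by metis
  then obtain v where v: "v \<in> \<Inter>\<Q>" by auto
  obtain Q where "Q \<in> \<Q>" using maxclD(1)[OF \<Q>] by auto
  then have "v \<in> V" using v maxclD(2)[OF \<Q>] maxclD(2)[of Q V R] by auto
  moreover have "\<Q> = {Q \<in> maxcl V R. v \<in> Q}"
  proof (intro subset_antisym subsetI)
    fix Q assume Q: "Q \<in> {Q \<in> maxcl V R. v \<in> Q}"
    then have "meets Q P" if "P \<in> \<Q>" for P using that v by (auto simp: meets_def)
    then show "Q \<in> \<Q>" using Q maxclD(4)[OF \<Q>, of Q] by blast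
  qed (use v maxclD(2)[OF \<Q>] in auto)
  ultimately show thesis using that by blast
qed

lemma card_maxcl_maxcl_le:
  assumes "finite V" "clique_Helly V R"
  shows "card (maxcl (maxcl V R) meets) \<le> card V"
proof -
  have "maxcl (maxcl V R) meets \<subseteq> (\<lambda>v. {Q \<in> maxcl V R. v \<in> Q}) ` V"
    using maxcl_meets_of_clique_Helly[OF assms(2)] by blast
  then show ?thesis using assms(1) by (rule surj_card_le[rotated])
qed

text \<open>Cliques of the clique graph are stars of vertices. The centres of pairwise meeting stars
  are pairwise related, and a clique containing all these centres belongs to every star.\<close>

lemma clique_Helly_maxcl:
  assumes "finite V" and refl: "\<And>x. x \<in> V \<Longrightarrow> R x x"
    and sym: "\<And>x y. x \<in> V \<Longrightarrow> y \<in> V \<Longrightarrow> R x y \<Longrightarrow> R y x"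
    and Helly: "clique_Helly V R"
  shows "clique_Helly (maxcl V R) meets"
  unfolding clique_Helly_def
proof (intro allI impI)
  fix F assume F: "F \<noteq> {} \<and> F \<subseteq> maxcl (maxcl V R) meets \<and> (\<forall>S\<in>F. \<forall>T\<in>F. meets S T)"
  let ?star = "\<lambda>v. {Q \<in> maxcl V R. v \<in> Q}"
  let ?S = "{v \<in> V. ?star v \<in> F}"
  have star: "\<exists>v\<in>?S. \<Q> = ?star v" if "\<Q> \<in> F" for \<Q>
    using maxcl_meets_of_clique_Helly[OF Helly, of \<Q>] that F by blast
  have "?S \<noteq> {}" using F star by blast
  moreover have "R x y" if xy: "x \<in> ?S" "y \<in> ?S" for x y
  proof -
    have "meets (?star x) (?star y)" using F xy by blast
    then obtain Q where "Q \<in> maxcl V R" "x \<in> Q" "y \<in> Q" unfolding meets_def by blast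
    then show ?thesis by (rule maxclD(3))
  qed
  ultimately obtain Q where Q: "Q \<in> maxcl V R" "?S \<subseteq> Q"
    using complete_extends_to_maxcl[of V R ?S] assms(1) refl sym by blast
  then have "Q \<in> \<Inter>F" using star by blast
  then show "\<Inter>F \<noteq> {}" by blast
qed

section \<open>Graphs of maximum degree four without octahedra\<close>

text \<open>Connectedness enters only through \<open>no_octahedron\<close>: in a connected graph
  with these degrees an octahedral subgraph is the whole graph. The three inequalities concern the
  antipodal pairs; the other pairs are distinct because adjacent.\<close>

locale low_degree_graph =
  fixes V :: "'a set" and E :: "'a \<Rightarrow> 'a \<Rightarrow> bool"
  assumes fin: "finite V"
    and E_in: "E u v \<Longrightarrow> u \<in> V"
    and E_sym: "E u v \<Longrightarrow> E v u"
    and E_irrefl: "\<not> E v v"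
    and deg: "card {w. E v w} \<le> 4"
    and no_octahedron: "\<lbrakk>E a b; E b c; E a c; E x b; E x c; x \<noteq> a; E y a; E y c; y \<noteq> b;
      E z a; E z b; z \<noteq> c; E x y; E y z; E x z\<rbrakk> \<Longrightarrow> False"
begin

lemma E_commute: "E u v \<longleftrightarrow> E v u"
  using E_sym by blast

lemma E_in2: "E u v \<Longrightarrow> v \<in> V"
  using E_in E_sym by blast

lemma finite_nbrs: "finite {w. E v w}"
  by (rule finite_subset[OF _ fin]) (auto dest: E_in2)

text \<open>Four distinct neighbours exhaust the degree bound; this is the form in which
  \<open>deg\<close> is used below.\<close>

lemma nbr_of_four:
  assumes "E v p" "E v q" "E v r" "E v s" "distinct [p, q, r, s]"
  shows "E v w \<longleftrightarrow> w \<in> {p, q, r, s}"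
proof -
  have "card {p, q, r, s} = 4" using assms(5) by simp
  moreover have "{p, q, r, s} \<subseteq> {w. E v w}" using assms by auto
  ultimately have "{p, q, r, s} = {w. E v w}"
    using card_seteq[OF finite_nbrs[of v], of "{p, q, r, s}"] deg[of v] by simp
  then show ?thesis by blast
qed

section \<open>Suns and their triangles\<close>

definition R :: "'a \<Rightarrow> 'a \<Rightarrow> bool" where
  "R u v \<longleftrightarrow> u = v \<or> E u v"

lemma R_refl [simp]: "R v v"
  by (simp add: R_def)

lemma R_sym: "R u v \<Longrightarrow> R v u"
  using E_sym by (auto simp: R_def)

text \<open>This is the 3-sun (Hajos graph) with central triangle \<open>a\<close>,
  \<open>b\<close>, \<open>c\<close> and outer vertices \<open>x\<close>, \<open>y\<close>,
  \<open>z\<close> opposite to them, except that adjacency among the outer vertices is left open. If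
  these are pairwise adjacent, the six vertices form an octahedron.\<close>

definition sun :: "'a \<Rightarrow> 'a \<Rightarrow> 'a \<Rightarrow> 'a \<Rightarrow> 'a \<Rightarrow> 'a \<Rightarrow> bool" where
  "sun a b c x y z \<longleftrightarrow> E a b \<and> E b c \<and> E a c \<and> E x b \<and> E x c \<and> \<not> R x a \<and>
     E y a \<and> E y c \<and> \<not> R y b \<and> E z a \<and> E z b \<and> \<not> R z c"

definition sun_triangles :: "'a set set" where
  "sun_triangles = {T. \<exists>a b c x y z. T = {a, b, c} \<and> sun a b c x y z}"

text \<open>Swapping and rotating generate all six labellings of a sun, so that arguments about one
  edge or corner of the triangle carry over to the others.\<close>

lemma sun_swap: "sun a b c x y z \<Longrightarrow> sun b a c y x z"
  by (auto simp: sun_def intro: E_sym)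

lemma sun_rotate: "sun a b c x y z \<Longrightarrow> sun b c a y z x"
  by (auto simp: sun_def intro: E_sym)

text \<open>Each central vertex already has four distinct neighbours within the sun.\<close>

lemma sun_nbrs:
  assumes "sun a b c x y z"
  shows "E a w \<longleftrightarrow> w \<in> {b, c, y, z}" "E b w \<longleftrightarrow> w \<in> {a, c, x, z}" "E c w \<longleftrightarrow> w \<in> {a, b, x, y}"
proof -
  have nbr1: "E a w \<longleftrightarrow> w \<in> {b, c, y, z}" if "sun a b c x y z" for a b c x y z
  proof (rule nbr_of_four)
    show "distinct [b, c, y, z]" using that E_irrefl E_sym by (auto simp: sun_def R_def)
  qed (use that E_sym in \<open>auto simp: sun_def\<close>)
  show "E a w \<longleftrightarrow> w \<in> {b, c, y, z}" by (rule nbr1[OF assms])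
  show "E b w \<longleftrightarrow> w \<in> {a, c, x, z}" by (rule nbr1[OF sun_swap[OF assms]])
  show "E c w \<longleftrightarrow> w \<in> {a, b, x, y}" by (rule nbr1[OF sun_rotate[OF sun_rotate[OF assms]]])
qed

lemma sun_distinct:
  assumes "sun a b c x y z"
  shows "distinct [a, b, c, x, y, z]"
  using assms E_irrefl E_sym unfolding sun_def R_def by (simp, metis)

lemma sun_not_octahedral: "sun a b c x y z \<Longrightarrow> E x y \<Longrightarrow> E y z \<Longrightarrow> E x z \<Longrightarrow> False"
  unfolding sun_def R_def using no_octahedron[of a b c x y z] by blast

lemma sun_in_V:
  assumes "sun a b c x y z"
  shows "a \<in> V" "b \<in> V" "c \<in> V" "x \<in> V" "y \<in> V" "z \<in> V"
  using assms E_in E_in2 unfolding sun_def by blast+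

lemma sun_triangles_edgeE:
  assumes "S \<in> sun_triangles" "p \<in> S" "q \<in> S" "p \<noteq> q"
  obtains r x y z where "S = {p, q, r}" "sun p q r x y z"
proof -
  obtain a b c x y z where S: "S = {a, b, c}" "sun a b c x y z"
    using assms(1) unfolding sun_triangles_def by blast
  note s = S(2) sun_swap[OF S(2)] sun_rotate[OF S(2)] sun_rotate[OF sun_rotate[OF S(2)]]
    sun_swap[OF sun_rotate[OF S(2)]] sun_swap[OF sun_rotate[OF sun_rotate[OF S(2)]]]
  have "p = a \<and> q = b \<or> p = b \<and> q = a \<or> p = b \<and> q = c \<or> p = c \<and> q = b \<or> p = a \<and> q = c \<or> p = c \<and> q = a"
    using assms S(1) by blast
  then show thesis
    by (elim disjE conjE) (rule that, use S(1) in blast, use s in blast)+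
qed

text \<open>When \<open>T\<close> is a triangle, \<open>v\<close> and the two witnesses form a
  complete set, which extends to a clique through \<open>v\<close> with two vertices in
  \<open>T\<close>; \<open>v\<close> may itself belong to \<open>T\<close>. In \<open>joined\<close>
  the four witnesses play the same role for two triangles.\<close>

definition near :: "'a \<Rightarrow> 'a set \<Rightarrow> bool" where
  "near v T \<longleftrightarrow> (\<exists>s\<in>T. \<exists>t\<in>T. s \<noteq> t \<and> R v s \<and> R v t)"

definition joined :: "'a set \<Rightarrow> 'a set \<Rightarrow> bool" where
  "joined T S \<longleftrightarrow> (\<exists>s\<in>T. \<exists>t\<in>T. \<exists>p\<in>S. \<exists>q\<in>S. s \<noteq> t \<and> p \<noteq> q \<and> R s p \<and> R s q \<and> R t p \<and> R t q)"

lemma joined_sym: "joined T S \<Longrightarrow> joined S T"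
  unfolding joined_def using R_sym by meson

lemma near_sun_iff:
  assumes s: "sun a b c x y z"
  shows "near v {a, b, c} \<longleftrightarrow> v \<in> {a, b, c, x, y, z}"
proof -
  have d: "distinct [a, b, c, x, y, z]" by (rule sun_distinct[OF s])
  have "R v a \<longleftrightarrow> v \<in> {a, b, c, y, z}" "R v b \<longleftrightarrow> v \<in> {b, a, c, x, z}" "R v c \<longleftrightarrow> v \<in> {c, a, b, x, y}"
    using sun_nbrs[OF s, of v] by (auto simp: R_def E_commute[of v])
  then show ?thesis using d unfolding near_def by auto
qed

text \<open>Only \<open>a\<close>, \<open>b\<close>, \<open>c\<close>, \<open>x\<close> are related
  to both \<open>b\<close> and \<open>c\<close>, so the edge \<open>pq\<close> lies among them and
  is not \<open>ax\<close>. For each such edge the neighbour lists leave two candidates for the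
  third vertex of \<open>S\<close>.\<close>

lemma joined_sun_aux:
  assumes s: "sun a b c x y z" and S: "S \<in> sun_triangles" "p \<in> S" "q \<in> S" "p \<noteq> q"
    and r: "R b p" "R b q" "R c p" "R c q"
  shows "S = {a, b, c} \<or> S = {b, c, x} \<or> S = {a, c, y} \<or> S = {a, b, z} \<or>
    S = {b, x, z} \<and> E x z \<or> S = {c, x, y} \<and> E x y"
proof -
  have d: "distinct [a, b, c, x, y, z]" by (rule sun_distinct[OF s])
  have nax: "\<not> E a x" "\<not> E x a" "\<not> E b y" "\<not> E c z" "\<not> E z c" "\<not> E y b" 
    using s E_sym by (auto simp: sun_def R_def)
  obtain t x' y' z' where t: "S = {p, q, t}" "sun p q t x' y' z'"
    by (rule sun_triangles_edgeE[OF S])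
  have e: "E p q" "E p t" "E q t" "E q p" "E t p" "E t q" using t(2) E_sym by (auto simp: sun_def)
  have pq: "p \<in> {a, b, c, x}" "q \<in> {a, b, c, x}"
    using r d sun_nbrs[OF s] by (auto simp: R_def)
  have St: "S = insert t {p, q}" using t(1) by blast
  have et: "E v t" if "v \<in> {p, q}" for v using that e by blast
  note n = sun_nbrs[OF s, of t]
  have "\<not> (p = a \<and> q = x)" "\<not> (p = x \<and> q = a)" using e(1) nax by auto
  then have "{p, q} = {b, c} \<or> {p, q} = {a, b} \<or> {p, q} = {a, c} \<or> {p, q} = {b, x} \<or> {p, q} = {c, x}"
    using pq S(4) by (simp add: doubleton_eq_iff) argo
  then consider "{p, q} = {b, c}" | "{p, q} = {a, b}" | "{p, q} = {a, c}" | "{p, q} = {b, x}" | "{p, q} = {c, x}"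
    by argo
  then show ?thesis
  proof cases
    case 1
    then have "E b t" "E c t" using et by auto
    then have "t = a \<or> t = x" using n d by auto
    then show ?thesis by (elim disjE conjE) (simp_all add: St 1 insert_commute)
  next
    case 2
    then have "E a t" "E b t" using et by auto
    then have "t = c \<or> t = z" using n d by auto
    then show ?thesis by (elim disjE conjE) (simp_all add: St 2 insert_commute)
  next
    case 3
    then have "E a t" "E c t" using et by auto
    then have "t = b \<or> t = y" using n d by auto
    then show ?thesis by (elim disjE conjE) (simp_all add: St 3 insert_commute)
  next
    case 4
    then have "E b t" "E x t" using et by auto
    then have "t = c \<or> t = z \<and> E x z" using n nax E_irrefl by auto
    then show ?thesis by (elim disjE conjE) (simp_all add: St 4 insert_commute)
  next
    case 5
    then have "E c t" "E x t" using et by auto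
    then have "t = b \<or> t = y \<and> E x y" using n nax E_irrefl by auto
    then show ?thesis by (elim disjE conjE) (simp_all add: St 5 insert_commute)
  qed
qed

text \<open>Any of the three edges of the triangle can witness \<open>joined\<close>; rotating the
  sun reduces each to \<open>joined_sun_aux\<close>. The outcomes are the triangle itself, a
  triangle across one of its edges, and a triangle made of one corner and two adjacent outer
  vertices.\<close>

lemma joined_sun_cases:
  assumes s: "sun a b c x y z" and S: "S \<in> sun_triangles" and j: "joined {a, b, c} S"
  shows "S = {a, b, c} \<or> S = {b, c, x} \<or> S = {a, c, y} \<or> S = {a, b, z} \<or>
    S = {a, y, z} \<and> E y z \<or> S = {b, x, z} \<and> E x z \<or> S = {c, x, y} \<and> E x y"
proof -
  note s3 = sun_rotate[OF s] sun_rotate[OF sun_rotate[OF s]]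
  obtain s t p q where st: "s \<in> {a, b, c}" "t \<in> {a, b, c}" "s \<noteq> t"
    and pq: "p \<in> S" "q \<in> S" "p \<noteq> q" "R s p" "R s q" "R t p" "R t q"
    using j unfolding joined_def by blast
  have ec: "E z y \<longleftrightarrow> E y z" "E z x \<longleftrightarrow> E x z" "E y x \<longleftrightarrow> E x y" using E_commute by auto
  have "s = b \<and> t = c \<or> s = c \<and> t = b \<or> s = c \<and> t = a \<or> s = a \<and> t = c \<or> s = a \<and> t = b \<or> s = b \<and> t = a"
    using st by blast
  then consider "R b p" "R b q" "R c p" "R c q" | "R c p" "R c q" "R a p" "R a q"
    | "R a p" "R a q" "R b p" "R b q"
    using pq(4-7) by (elim disjE conjE) simp_all
  then show ?thesis
  proof cases
    case 1 then show ?thesis using joined_sun_aux[OF s S pq(1-3)] by argo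
  next
    case 2
    have p: "{b, c, a} = {a, b, c}" "{c, a, y} = {a, c, y}" "{b, a, z} = {a, b, z}"
      "{c, y, x} = {c, x, y}" by blast+
    show ?thesis using joined_sun_aux[OF s3(1) S pq(1-3) 2] unfolding p ec by argo
  next
    case 3
    have p: "{c, a, b} = {a, b, c}" "{c, b, x} = {b, c, x}" "{c, a, y} = {a, c, y}" "{a, z, y} = {a, y, z}"
      "{b, z, x} = {b, x, z}" by blast+
    show ?thesis using joined_sun_aux[OF s3(2) S pq(1-3) 3] unfolding p ec by argo
  qed
qed

lemma sun_in_triangles: "sun a b c x y z \<Longrightarrow> {a, b, c} \<in> sun_triangles"
  unfolding sun_triangles_def by blast

lemma joinedI:
  "s \<in> T \<Longrightarrow> t \<in> T \<Longrightarrow> p \<in> S \<Longrightarrow> q \<in> S \<Longrightarrow> s \<noteq> t \<Longrightarrow> p \<noteq> q \<Longrightarrow> R s p \<Longrightarrow> R s q \<Longrightarrow> R t p \<Longrightarrow> R t q \<Longrightarrow>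
    joined T S"
  unfolding joined_def by blast

lemma joined_common_edge:
  "p \<in> T \<Longrightarrow> q \<in> T \<Longrightarrow> p \<in> S \<Longrightarrow> q \<in> S \<Longrightarrow> E p q \<Longrightarrow> joined T S"
  by (rule joinedI[of p T q p S q]) (use E_irrefl E_sym in \<open>auto simp: R_def\<close>)

lemma sun_triangles_E: "S \<in> sun_triangles \<Longrightarrow> p \<in> S \<Longrightarrow> q \<in> S \<Longrightarrow> R p q"
  unfolding sun_triangles_def sun_def R_def using E_sym by blast

lemma sun_trianglesE:
  assumes "S \<in> sun_triangles" "p \<in> S"
  obtains q r x y z where "S = {p, q, r}" "sun p q r x y z"
proof -
  obtain a b c x y z where S: "S = {a, b, c}" "sun a b c x y z"
    using assms(1) unfolding sun_triangles_def by blast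
  then have "a \<in> S" "b \<in> S" "a \<noteq> b" using E_irrefl by (auto simp: sun_def)
  then obtain q where "q \<in> S" "p \<noteq> q" by metis
  then show thesis using sun_triangles_edgeE[OF assms] that by metis
qed

lemma joined_refl:
  assumes "T \<in> sun_triangles"
  shows "joined T T"
proof -
  obtain a b c x y z where "T = {a, b, c}" "sun a b c x y z"
    using assms unfolding sun_triangles_def by blast
  then show ?thesis using joined_common_edge[of a T b T] by (auto simp: sun_def)
qed

text \<open>As a sun triangle, \<open>{b, c, x}\<close> needs an outer vertex over each of its
  edges. Over \<open>cx\<close> the neighbours of \<open>c\<close> offer only \<open>y\<close>, and
  over \<open>bx\<close> those of \<open>b\<close> offer only \<open>z\<close>.\<close>

lemma sun_triangle_on_edge:
  assumes s: "sun a b c x y z" and S: "{b, c, x} \<in> sun_triangles"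
  shows "E x y" "E x z"
proof -
  have d: "distinct [a, b, c, x, y, z]" by (rule sun_distinct[OF s])
  obtain r X Y Z where r: "{b, c, x} = {b, x, r}" "sun b x r X Y Z"
    by (rule sun_triangles_edgeE[OF S, of b x]) (use d in auto)
  have "c \<in> {b, x, r}" by (simp flip: r(1))
  then have "r = c" using d by auto
  then have s': "sun b x c X Y Z" using r(2) by simp
  have nax: "\<not> E a x" using s E_sym by (auto simp: sun_def R_def)
  have X: "E c X" "E x X" "X \<noteq> b" and Z: "E b Z" "E x Z" "Z \<noteq> c"
    using s' E_sym by (auto simp: sun_def R_def)
  have "X = y" using X nax E_irrefl E_sym sun_nbrs(3)[OF s, of X] by auto
  then show "E x y" using X by simp
  have "Z = z" using Z nax E_irrefl E_sym sun_nbrs(2)[OF s, of Z] by auto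
  then show "E x z" using Z by simp
qed

text \<open>The neighbours of \<open>b\<close> leave only \<open>a\<close> and \<open>c\<close> as
  outer vertices over \<open>bz\<close> and \<open>bx\<close>. The third outer vertex
  \<open>u\<close> is adjacent to \<open>x\<close> and \<open>z\<close>, so \<open>u = y\<close>
  would complete an octahedron.\<close>

lemma sun_triangle_opposite:
  assumes s: "sun a b c x y z" and S: "{b, x, z} \<in> sun_triangles"
  obtains u where "sun b x z u a c" "u \<noteq> y"
proof -
  have d: "distinct [a, b, c, x, y, z]" by (rule sun_distinct[OF s])
  obtain r X Y Z where r: "{b, x, z} = {b, x, r}" "sun b x r X Y Z"
    by (rule sun_triangles_edgeE[OF S, of b x]) (use d in auto)
  have "z \<in> {b, x, r}" by (simp flip: r(1))
  then have "r = z" using d by auto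
  then have s': "sun b x z X Y Z" using r(2) by simp
  have n: "\<not> E a x" "\<not> E z c" "\<not> E c z" using s E_sym by (auto simp: sun_def R_def)
  have Y: "E b Y" "E z Y" "Y \<noteq> x" and Z: "E b Z" "E x Z" "Z \<noteq> z"
    using s' E_sym by (auto simp: sun_def R_def)
  have "Y = a" using Y n E_irrefl E_sym sun_nbrs(2)[OF s, of Y] by auto
  moreover have "Z = c" using Z n E_irrefl E_sym sun_nbrs(2)[OF s, of Z] by auto
  moreover have "X \<noteq> y"
    using sun_not_octahedral[OF s] s' E_sym by (auto simp: sun_def)
  ultimately show thesis using that s' by blast
qed

section \<open>Points and domination between them\<close>

text \<open>
  \<open>Inl v\<close> stands for the family of cliques through \<open>v\<close>, \<open>Inr T\<close> for the
  family of cliques having two vertices in \<open>T\<close>; \<open>point_rel\<close> says that these families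
  meet (\<open>meets_family_iff\<close>).
\<close>

fun point_rel :: "'a + 'a set \<Rightarrow> 'a + 'a set \<Rightarrow> bool" where
  "point_rel (Inl u) (Inl v) = R u v"
| "point_rel (Inl v) (Inr T) = near v T"
| "point_rel (Inr T) (Inl v) = near v T"
| "point_rel (Inr T) (Inr S) = joined T S"

definition points :: "('a + 'a set) set" where
  "points = Inl ` V \<union> Inr ` sun_triangles"

lemma point_rel_sym: "point_rel p q \<Longrightarrow> point_rel q p"
  by (cases p; cases q) (auto intro: R_sym joined_sym)

lemma point_rel_refl: "p \<in> points \<Longrightarrow> point_rel p p"
  by (auto simp: points_def intro: joined_refl)

text \<open>All neighbours of \<open>a\<close> are near \<open>T\<close>. A sun triangle near
  \<open>a\<close> either contains \<open>a\<close> and a further neighbour of it, or contains two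
  adjacent neighbours of \<open>a\<close>; the delicate case is the edge \<open>yz\<close>, where an
  octahedron would arise.\<close>

lemma sun_vertex_dominated:
  assumes T: "T \<in> sun_triangles" "a \<in> T" and w: "w \<in> points" "point_rel w (Inl a)"
  shows "point_rel w (Inr T)"
proof -
  obtain b c x y z where Teq: "T = {a, b, c}" and s: "sun a b c x y z"
    by (rule sun_trianglesE[OF T])
  note d = sun_distinct[OF s]
  note n = sun_nbrs[OF s]
  have e: "E a b" "E a c" "E b c" "E a y" "E a z" "E b z" "E c y" "\<not> E b y" "\<not> E c z" "\<not> E y b" "\<not> E z c"
    using s E_sym by (auto simp: sun_def R_def)
  have Rsy: "R u v" if "E u v \<or> E v u \<or> u = v" for u v using that E_sym by (auto simp: R_def)
  have jb: "joined T S" if "b \<in> S" "z \<in> S" for S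
    by (rule joinedI[of a T b b S z]) (use that Teq e d in \<open>auto intro: Rsy\<close>)
  have jc: "joined T S" if "c \<in> S" "y \<in> S" for S
    by (rule joinedI[of a T c c S y]) (use that Teq e d in \<open>auto intro: Rsy\<close>)
  have jaz: "joined T S" if "a \<in> S" "z \<in> S" for S
    by (rule joinedI[of a T b a S z]) (use that Teq e d in \<open>auto intro: Rsy\<close>)
  show ?thesis
  proof (cases w)
    case (Inl v)
    then have "R v a" using w by simp
    then have "v \<in> {a, b, c, y, z}" using n(1)[of v] E_sym by (auto simp: R_def)
    then show ?thesis using near_sun_iff[OF s, of v] Inl Teq by auto
  next
    case (Inr S)
    then have S: "S \<in> sun_triangles" "near a S" using w by (auto simp: points_def)
    have "joined T S"
    proof (cases "a \<in> S")
      case True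
      then obtain q r X Y Z where q: "S = {a, q, r}" "sun a q r X Y Z"
        using sun_trianglesE[OF S(1)] by metis
      have "E a q" "E a r" "q \<noteq> r" using q(2) E_irrefl by (auto simp: sun_def)
      then have "b \<in> S \<or> c \<in> S \<or> z \<in> S" using n(1) q(1) by auto
      then show ?thesis
        using True joined_common_edge[of a T b S] joined_common_edge[of a T c S] jaz e Teq by auto
    next
      case False
      obtain p q where pq: "p \<in> S" "q \<in> S" "p \<noteq> q" "R a p" "R a q"
        using S(2) unfolding near_def by blast
      have E: "E a p" "E a q" using pq False by (auto simp: R_def)
      have Epq: "E p q" using sun_triangles_E[OF S(1) pq(1,2)] pq(3) by (simp add: R_def)
      have "p \<in> {b, c, y, z}" "q \<in> {b, c, y, z}" using E n(1) by blast+
      then have "b \<in> S \<and> c \<in> S \<or> b \<in> S \<and> z \<in> S \<or> c \<in> S \<and> y \<in> S \<or> y \<in> S \<and> z \<in> S \<and> E y z"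
        using pq(1-3) Epq E_sym[OF Epq] e(8-11) by (elim insertE emptyE) simp_all
      then show ?thesis
      proof (elim disjE conjE)
        assume "b \<in> S" "c \<in> S" then show ?thesis using joined_common_edge[of b T c S] Teq e by auto
      next
        \<comment> \<open>The outer vertex \<open>Y\<close> of \<open>S\<close> over the edge
          \<open>yr\<close> is a neighbour of \<open>y\<close> other than \<open>a\<close>,
          \<open>z\<close>, \<open>r\<close>, hence it is \<open>c\<close>. So \<open>r\<close> is a
          neighbour of \<open>c\<close>, which forces \<open>r = x\<close> and makes
          \<open>x\<close>, \<open>y\<close>, \<open>z\<close> pairwise adjacent.\<close>
        assume yz: "y \<in> S" "z \<in> S" "E y z"
        obtain r X Y Z where r: "S = {y, z, r}" "sun y z r X Y Z"
          by (rule sun_triangles_edgeE[OF S(1) yz(1,2)]) (use d in auto)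
        have ry: "E y r" "E r z" "r \<noteq> z" "r \<noteq> a" using r False by (auto simp: sun_def R_def E_commute)
        have Y: "E Y y" "E Y r" "Y \<noteq> z" "\<not> E Y z" using r(2) by (auto simp: sun_def R_def)
        have "r \<noteq> c" using ry e E_sym by auto
        then have "E y w \<longleftrightarrow> w \<in> {a, c, z, r}" for w
          by (intro nbr_of_four) (use d ry e yz E_sym in auto)
        then have "Y \<in> {a, c, z, r}" using Y(1) E_sym by blast
        then have "Y = c" using Y e E_irrefl E_sym by auto
        then have "r \<in> {a, b, x, y}" using Y(2) n(3) by blast
        then have "r = x" using ry e E_irrefl E_sym by auto
        then show ?thesis using sun_not_octahedral[OF s] ry yz E_sym by blast
      qed (use jb jc in auto)
    qed
    then show ?thesis using Inr joined_sym by auto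
  qed
qed

text \<open>The vertices near \<open>S\<close> but outside it are the three outer vertices of its
  sun, whose labels can be permuted so that the given two come first.\<close>

lemma near_outerE:
  assumes S: "S \<in> sun_triangles" and n: "near x S" "near y S" "x \<noteq> y" "x \<notin> S" "y \<notin> S"
  obtains a b c z where "S = {a, b, c}" "sun a b c x y z"
proof -
  obtain a b c x' y' z' where S: "S = {a, b, c}" "sun a b c x' y' z'"
    using S unfolding sun_triangles_def by blast
  note s = S(2) sun_swap[OF S(2)] sun_rotate[OF S(2)] sun_rotate[OF sun_rotate[OF S(2)]]
    sun_swap[OF sun_rotate[OF S(2)]] sun_swap[OF sun_rotate[OF sun_rotate[OF S(2)]]]
  have "x \<in> {x', y', z'}" "y \<in> {x', y', z'}" using n near_sun_iff[OF S(2)] S(1) by auto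
  then have "x = x' \<and> y = y' \<or> x = y' \<and> y = x' \<or> x = y' \<and> y = z' \<or> x = z' \<and> y = y' \<or> x = x' \<and> y = z' \<or> x = z' \<and> y = x'"
    using n(3) by blast
  then show thesis
    by (elim disjE conjE) (rule that[rotated], use s in blast, use S(1) in blast)+
qed

text \<open>\<open>T\<close> has a corner \<open>c\<close> adjacent to \<open>x\<close> and
  \<open>y\<close>. Any other common neighbour of \<open>x\<close> and \<open>y\<close> is adjacent
  to \<open>c\<close>, as otherwise \<open>{c, x, y}\<close> would be a sun triangle. So vertices
  related to both \<open>x\<close> and \<open>y\<close> are near \<open>T\<close>. A sun triangle
  \<open>S\<close> near both must contain \<open>c\<close>; it dominates the point of
  \<open>c\<close>, to which \<open>T\<close> is related.\<close>

lemma outer_edge_dominated: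
  assumes T: "T \<in> sun_triangles" and xy: "E x y" "near x T" "near y T"
    and outer: "x \<notin> \<Union>sun_triangles" "y \<notin> \<Union>sun_triangles"
    and w: "w \<in> points" "point_rel w (Inl x)" "point_rel w (Inl y)"
  shows "point_rel w (Inr T)"
proof -
  have "x \<noteq> y" using xy E_irrefl by auto
  then obtain a b c z where Teq: "T = {a, b, c}" and s: "sun a b c x y z"
    using near_outerE[OF T xy(2,3)] outer T by blast
  note n = sun_nbrs[OF s]
  have e: "E c x" "E c y" "E a c" "E a y" "E b c" "E b x" "\<not> R a x" "\<not> R b y"
    using s E_sym by (auto simp: sun_def R_def)
  have no_apex: False if "E v x" "E v y" "\<not> R v c" for v
  proof -
    have "sun c x y v a b" using that e xy(1) by (simp add: sun_def)
    then show False using sun_in_triangles[of c x y] outer by blast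
  qed
  show ?thesis
  proof (cases w)
    case (Inl v)
    then have v: "R v x" "R v y" using w by auto
    have "v \<in> {x, y, c} \<or> E c v"
      using no_apex[of v] v E_sym by (auto simp: R_def)
    then have "v \<in> {a, b, c, x, y, z}" using n(3) by auto
    then show ?thesis using near_sun_iff[OF s] Inl Teq by simp
  next
    case (Inr S)
    then have S: "S \<in> sun_triangles" "near x S" "near y S" using w by (auto simp: points_def)
    then obtain p q r z' where Seq: "S = {p, q, r}" and s': "sun p q r x y z'"
      using near_outerE[OF S(1-3) \<open>x \<noteq> y\<close>] outer by blast
    have r: "E r x" "E r y" "r \<in> S" using s' E_sym Seq by (auto simp: sun_def)
    have "r = c"
    proof (rule ccontr)
      assume "r \<noteq> c"
      have "\<not> E c r"
      proof
        assume "E c r"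
        then have "r = a \<or> r = b \<or> r = x \<or> r = y" using n(3) by blast
        then show False using r e E_irrefl by (auto simp: R_def)
      qed
      then show False using no_apex[of r] r \<open>r \<noteq> c\<close> E_sym by (auto simp: R_def)
    qed
    then have "point_rel (Inr T) (Inr S)"
      using sun_vertex_dominated[OF S(1) r(3), of "Inr T"] near_sun_iff[OF s] T Teq
      by (simp add: points_def)
    then show ?thesis using Inr joined_sym by simp
  qed
qed

text \<open>Here \<open>x\<close> is adjacent to \<open>y\<close> and \<open>z\<close>, so
  \<open>y\<close> and \<open>z\<close> are not adjacent. Thus all six vertices of the sun are near
  \<open>{b, c, x}\<close>. Among the triangles joined to \<open>{a, b, c}\<close>, those on
  \<open>acy\<close>, \<open>abz\<close> and \<open>ayz\<close> are excluded, and each of the others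
  shares an edge with \<open>{b, c, x}\<close>.\<close>

lemma sun_triangle_on_edge_dominates:
  assumes s: "sun a b c x y z" and S: "{b, c, x} \<in> sun_triangles"
    and w: "w \<in> points" "point_rel w (Inr {a, b, c})"
  shows "point_rel w (Inr {b, c, x})"
proof -
  note xe = sun_triangle_on_edge[OF s S]
  have nyz: "\<not> E y z" "\<not> E z y" using sun_not_octahedral[OF s] xe E_sym by blast+
  have e: "E b c" "E b x" "E c x" "E a b" "E a c" "E y c" "E y x" "E z b" "E z x"
    using s xe E_sym by (auto simp: sun_def)
  have ne: "b \<noteq> c" "c \<noteq> x" "b \<noteq> x" using e E_irrefl by auto
  show ?thesis
  proof (cases w)
    case (Inl v)
    then have "v \<in> {a, b, c, x, y, z}" using w near_sun_iff[OF s] by simp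
    then have "near v {b, c, x}" unfolding near_def R_def using e ne E_sym
      by (elim insertE emptyE) auto
    then show ?thesis using Inl by simp
  next
    case (Inr Q)
    then have Q: "Q \<in> sun_triangles" "joined {a, b, c} Q" using w joined_sym by (auto simp: points_def)
    have "joined {b, c, x} Q"
      using joined_sun_cases[OF s Q]
    proof (elim disjE conjE)
      assume Qe: "Q = {a, c, y}"
      have "{a, c, y} = {c, a, y}" by blast
      then show ?thesis using sun_triangle_on_edge(1)[OF sun_rotate[OF s]] Qe Q(1) nyz by simp
    next
      assume Qe: "Q = {a, b, z}"
      then show ?thesis using sun_triangle_on_edge(2)[OF sun_rotate[OF sun_rotate[OF s]]] Q(1) nyz by simp
    next
      assume "Q = {b, c, x}" then show ?thesis using joined_refl[OF S] by simp
    next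
      assume "Q = {a, b, c}" then show ?thesis using joined_common_edge[of b _ c] e by simp
    next
      assume "Q = {b, x, z}" then show ?thesis using joined_common_edge[of b _ x] e by simp
    next
      assume "Q = {c, x, y}" then show ?thesis using joined_common_edge[of c _ x] e by simp
    qed (use nyz in auto)
    then show ?thesis using Inr joined_sym by simp
  qed
qed

text \<open>If the two triangles share an edge, then \<open>S\<close> dominates \<open>T\<close>. If
  they share only a corner, relabelling leads to the configuration of
  \<open>sun_triangle_opposite\<close>.\<close>

lemma joined_sun_triangles_cases:
  assumes T: "T \<in> sun_triangles" "S \<in> sun_triangles" "joined T S" "T \<noteq> S"
  obtains "\<And>w. w \<in> points \<Longrightarrow> point_rel w (Inr T) \<Longrightarrow> point_rel w (Inr S)"
  | a b c x y z u where "T = {a, b, c}" "S = {b, x, z}" "sun a b c x y z" "sun b x z u a c" "u \<noteq> y"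
proof -
  obtain a b c x y z where Teq: "T = {a, b, c}" and s: "sun a b c x y z"
    using T(1) unfolding sun_triangles_def by blast
  note s1 = sun_rotate[OF s] and s2 = sun_rotate[OF sun_rotate[OF s]]
  have T1: "T = {b, c, a}" and T2: "T = {c, a, b}" using Teq by blast+
  from joined_sun_cases[OF s T(2) T(3)[unfolded Teq]]
  have "S = {a, b, c} \<or> S = {b, c, x} \<or> S = {a, c, y} \<or> S = {a, b, z} \<or>
    S = {a, y, z} \<or> S = {b, x, z} \<or> S = {c, x, y}" by argo
  then show thesis
  proof (elim disjE)
    assume "S = {a, b, c}" then show thesis using T(4) Teq by simp
  next
    assume "S = {b, c, x}"
    then show thesis using sun_triangle_on_edge_dominates[OF s] T(2) that(1) Teq by simp
  next
    assume Se: "S = {a, c, y}"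
    have "{a, c, y} = {c, a, y}" by blast
    then show thesis using sun_triangle_on_edge_dominates[OF s1] T(2) that(1) T1 Se by simp
  next
    assume "S = {a, b, z}"
    then show thesis using sun_triangle_on_edge_dominates[OF s2] T(2) that(1) T2 by simp
  next
    assume S: "S = {b, x, z}"
    then obtain u where "sun b x z u a c" "u \<noteq> y" using sun_triangle_opposite[OF s] T(2) by metis
    then show thesis using that(2)[of a b c x z y u] Teq S s by simp
  next
    assume S: "S = {c, x, y}"
    have "{c, y, x} = S" using S by blast
    then obtain u where "sun c y x u b a" "u \<noteq> z" using sun_triangle_opposite[OF s1] T(2) by metis
    then show thesis using that(2)[of b c a y x z u] T1 \<open>{c, y, x} = S\<close> s1 by simp
  next
    assume S: "S = {a, y, z}"
    have "{a, z, y} = S" using S by blast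
    then obtain u where "sun a z y u c b" "u \<noteq> x" using sun_triangle_opposite[OF s2] T(2) by metis
    then show thesis using that(2)[of c a b z y x u] T2 \<open>{a, z, y} = S\<close> s2 by simp
  qed
qed

section \<open>Extended triangles of points\<close>

abbreviation dominated_triple :: "'a + 'a set \<Rightarrow> 'a + 'a set \<Rightarrow> 'a + 'a set \<Rightarrow> bool" where
  "dominated_triple \<equiv> extended_triangle_dominated points point_rel"

lemma dominated_triple_sym:
  "dominated_triple p q r \<Longrightarrow> dominated_triple q p r"
  "dominated_triple p q r \<Longrightarrow> dominated_triple q r p"
  unfolding extended_triangle_dominated_def by blast+

text \<open>With \<open>p\<close> itself as the dominating point, only those \<open>w\<close>
  related to both \<open>q\<close> and \<open>r\<close> require a check.\<close>

lemma dominated_tripleI: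
  assumes "p \<in> points" "\<And>w. w \<in> points \<Longrightarrow> point_rel w q \<Longrightarrow> point_rel w r \<Longrightarrow> point_rel w p"
  shows "dominated_triple p q r"
  using assms unfolding extended_triangle_dominated_def by blast

lemma dominated_triple_apex_vertex_vertex:
  assumes T: "T \<in> sun_triangles" and pq: "point_rel (Inr T) (Inl p)" "point_rel (Inr T) (Inl q)" "point_rel (Inl p) (Inl q)"
    and outer: "p \<notin> \<Union>sun_triangles" "q \<notin> \<Union>sun_triangles" and V: "p \<in> V"
  shows "dominated_triple (Inr T) (Inl p) (Inl q)"
proof (cases "p = q")
  case True
  have "dominated_triple (Inl p) (Inr T) (Inl q)"
    by (rule dominated_tripleI) (use V True in \<open>auto simp: points_def\<close>)
  then show ?thesis by (rule dominated_triple_sym)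
next
  case False
  show ?thesis
    by (rule dominated_tripleI) (use outer_edge_dominated[OF T] pq outer False T in \<open>auto simp: points_def R_def\<close>)
qed

lemma dominated_triple_apex_apex_vertex:
  assumes T: "T \<in> sun_triangles" "S \<in> sun_triangles" "joined T S"
    and p: "near p T" "near p S" "p \<notin> \<Union>sun_triangles"
  shows "dominated_triple (Inr T) (Inr S) (Inl p)"
proof -
  have "dominated_triple (Inr S) (Inr T) (Inl p)"
  proof (cases "T = S")
    case True
    show ?thesis by (rule dominated_tripleI) (use T True in \<open>auto simp: points_def\<close>)
  next
    case False
    from T False show ?thesis
    proof (cases rule: joined_sun_triangles_cases)
      case 1
      show ?thesis by (rule dominated_tripleI) (use T 1 in \<open>auto simp: points_def\<close>)
    next
      case (2 a b c x y z u)
      \<comment> \<open>Being near both triangles and in neither, \<open>p\<close> must be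
        \<open>y\<close> by the first sun and \<open>u\<close> by the second, although
        \<open>u \<noteq> y\<close>.\<close>
      have "p \<in> {a, b, c, x, y, z}" "p \<in> {b, x, z, u, a, c}"
        using p near_sun_iff[OF 2(3)] near_sun_iff[OF 2(4)] 2 by auto
      moreover have "p \<notin> T" "p \<notin> S" using p T by auto
      ultimately show ?thesis using 2(1,2,5) by auto
    qed
  qed
  then show ?thesis by (rule dominated_triple_sym)
qed

text \<open>A triangle that dominates another of the three is the required point. Otherwise
  \<open>T\<close> and \<open>S\<close> share only a corner, and it remains to see that
  \<open>Q\<close> lies across an edge of \<open>T\<close> or equals \<open>S\<close>.\<close>

lemma dominated_triple_apex_apex_apex:
  assumes T: "T \<in> sun_triangles" "S \<in> sun_triangles" "Q \<in> sun_triangles"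
    and j: "joined T S" "joined T Q" "joined S Q"
  shows "dominated_triple (Inr T) (Inr S) (Inr Q)"
proof -
  have P: "Inr T \<in> points" "Inr S \<in> points" "Inr Q \<in> points" using T by (auto simp: points_def)
  have S: "dominated_triple (Inr T) (Inr S) (Inr Q)"
    if "\<And>w. w \<in> points \<Longrightarrow> point_rel w (Inr T) \<Longrightarrow> point_rel w (Inr S)"
    using dominated_tripleI[OF P(2), of "Inr T" "Inr Q"] that dominated_triple_sym by blast
  have Q: "dominated_triple (Inr T) (Inr S) (Inr Q)"
    if "\<And>w. w \<in> points \<Longrightarrow> point_rel w (Inr T) \<Longrightarrow> point_rel w (Inr Q)"
    using dominated_tripleI[OF P(3), of "Inr T" "Inr S"] that dominated_triple_sym by blast
  show ?thesis
  proof (cases "T = S \<or> T = Q")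
    case True then show ?thesis using S Q by blast
  next
    case False
    then have TS: "T \<noteq> S" and TQ: "T \<noteq> Q" by auto
    from T(1,2) j(1) TS show ?thesis
    proof (cases rule: joined_sun_triangles_cases)
      case 1 then show ?thesis by (rule S)
    next
      case (2 a b c x y z u)
      note s = 2(3) and s' = 2(4)
      note s1 = sun_rotate[OF s] and s2 = sun_rotate[OF sun_rotate[OF s]]
      have T1: "T = {b, c, a}" and T2: "T = {c, a, b}" using 2(1) by blast+
      have d: "distinct [a, b, c, x, y, z]" by (rule sun_distinct[OF s])
      \<comment> \<open>\<open>x\<close> and \<open>z\<close> are corners of \<open>S\<close>, so
        their neighbours lie in its sun on \<open>b\<close>, \<open>x\<close>, \<open>z\<close>,
        \<open>u\<close>, \<open>a\<close>, \<open>c\<close>, which does not contain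
        \<open>y\<close>. Hence \<open>Q\<close> cannot be attached at the corner \<open>a\<close>
        or \<open>c\<close> of \<open>T\<close>.\<close>
      have ny: "\<not> E z y" "\<not> E x y"
        using sun_nbrs(2,3)[OF s', of y] d 2(5) by auto
      from joined_sun_cases[OF s T(3) j(2)[unfolded 2(1)]]
      have "Q = {a, b, c} \<or> Q = {b, c, x} \<or> Q = {a, c, y} \<or> Q = {a, b, z} \<or>
        Q = {a, y, z} \<and> E y z \<or> Q = {b, x, z} \<or> Q = {c, x, y} \<and> E x y" by argo
      then show ?thesis
      proof (elim disjE conjE)
        assume "Q = {a, b, c}" then show ?thesis using TQ 2(1) by simp
      next
        assume "Q = {b, c, x}"
        then show ?thesis using sun_triangle_on_edge_dominates[OF s] T(3) Q 2(1) by simp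
      next
        assume Qe: "Q = {a, c, y}"
        have "{a, c, y} = {c, a, y}" by blast
        then show ?thesis using sun_triangle_on_edge_dominates[OF s1] T(3) Q T1 Qe by simp
      next
        assume "Q = {a, b, z}"
        then show ?thesis using sun_triangle_on_edge_dominates[OF s2] T(3) Q T2 by simp
      next
        assume "Q = {b, x, z}"
        then have "Q = S" using 2(2) by simp
        have "dominated_triple (Inr S) (Inr Q) (Inr T)"
          by (rule dominated_tripleI[OF P(2)]) (simp add: \<open>Q = S\<close>)
        then show ?thesis using dominated_triple_sym by blast
      qed (use ny E_sym in blast)+
    qed
  qed
qed

text \<open>A sun triangle near \<open>q\<close> and \<open>r\<close> has a corner \<open>c\<close>
  adjacent to both. By \<open>dom\<close> this corner is related to \<open>p\<close>, so
  \<open>p\<close> is one of the six vertices of the sun and hence near the triangle.\<close>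

lemma dominated_triple_vertices_aux:
  assumes pqr: "E p q" "E p r" "E q r"
    and outer: "q \<notin> \<Union>sun_triangles" "r \<notin> \<Union>sun_triangles"
    and dom: "\<And>v. E v q \<Longrightarrow> E v r \<Longrightarrow> R v p"
  shows "dominated_triple (Inl p) (Inl q) (Inl r)"
proof (rule dominated_tripleI)
  show "Inl p \<in> points" using pqr E_in by (auto simp: points_def)
  fix w assume w: "w \<in> points" "point_rel w (Inl q)" "point_rel w (Inl r)"
  show "point_rel w (Inl p)"
  proof (cases w)
    case (Inl v)
    then have "R v q" "R v r" using w by auto
    then have "R v p" using dom[of v] pqr E_sym by (auto simp: R_def)
    then show ?thesis using Inl by simp
  next
    case (Inr T)
    then have T: "T \<in> sun_triangles" "near q T" "near r T" using w by (auto simp: points_def)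
    have "q \<noteq> r" using pqr E_irrefl by auto
    then obtain a b c z where Teq: "T = {a, b, c}" and s: "sun a b c q r z"
      using near_outerE[OF T] outer T(1) by blast
    have "R c p" using dom[of c] s E_sym by (auto simp: sun_def)
    then have "p \<in> {a, b, c, q, r, z}" using sun_nbrs(3)[OF s, of p] by (auto simp: R_def)
    then show ?thesis using Inr Teq near_sun_iff[OF s] by simp
  qed
qed

lemma dominated_triple_vertices:
  assumes pqr: "R p q" "R p r" "R q r" and V: "p \<in> V" "q \<in> V" "r \<in> V"
    and outer: "p \<notin> \<Union>sun_triangles" "q \<notin> \<Union>sun_triangles" "r \<notin> \<Union>sun_triangles"
  shows "dominated_triple (Inl p) (Inl q) (Inl r)"
proof (cases "p = q \<or> p = r \<or> q = r")
  case True
  have P: "Inl p \<in> points" "Inl q \<in> points" "Inl r \<in> points" using V by (auto simp: points_def)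
  show ?thesis using True P unfolding extended_triangle_dominated_def by blast
next
  case False
  then have e: "E p q" "E p r" "E q r" "E q p" "E r p" "E r q" using pqr E_sym by (auto simp: R_def)
  have "\<not> sun p q r x y z" for x y z using sun_in_triangles[of p q r x y z] outer by blast
  \<comment> \<open>Since \<open>{p, q, r}\<close> is not a sun triangle, one of its edges has all
    its common neighbours related to the opposite corner, and that corner dominates.\<close>
  then consider "\<And>v. E v q \<Longrightarrow> E v r \<Longrightarrow> R v p" | "\<And>v. E v p \<Longrightarrow> E v r \<Longrightarrow> R v q" | "\<And>v. E v p \<Longrightarrow> E v q \<Longrightarrow> R v r"
    unfolding sun_def using e by blast
  then show ?thesis
  proof cases
    case 1 then show ?thesis using dominated_triple_vertices_aux[of p q r] e outer by blast
  next
    case 2 then have "dominated_triple (Inl q) (Inl p) (Inl r)" using dominated_triple_vertices_aux[of q p r] e outer by blast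
    then show ?thesis by (rule dominated_triple_sym)
  next
    case 3 then have "dominated_triple (Inl r) (Inl p) (Inl q)" using dominated_triple_vertices_aux[of r p q] e outer by blast
    then show ?thesis by (rule dominated_triple_sym)
  qed
qed

text \<open>By \<open>sun_vertex_dominated\<close> a corner of a sun triangle can be exchanged for
  the point of that triangle; all other points are kept.\<close>

lemma point_dominatedE:
  assumes "p \<in> points"
  obtains p' where "p' \<in> points" "\<And>w. w \<in> points \<Longrightarrow> point_rel w p \<Longrightarrow> point_rel w p'"
    "(\<exists>v. p' = Inl v \<and> v \<in> V \<and> v \<notin> \<Union>sun_triangles) \<or> (\<exists>T\<in>sun_triangles. p' = Inr T)"
proof (cases "\<exists>v T. p = Inl v \<and> v \<in> T \<and> T \<in> sun_triangles")
  case True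
  then obtain v T where T: "p = Inl v" "v \<in> T" "T \<in> sun_triangles" by blast
  show thesis
    by (rule that[of "Inr T"]) (use T sun_vertex_dominated[OF T(3,2)] in \<open>auto simp: points_def\<close>)
next
  case False
  show thesis by (rule that[of p]) (use assms False in \<open>auto simp: points_def\<close>)
qed

text \<open>Each point is exchanged for one from \<open>point_dominatedE\<close>. Related points
  stay related, and a point related to two of the old points is related to two of the new ones, so
  whatever dominates the new triple dominates the old one. What remains is a case distinction by
  kinds.\<close>

lemma dominated_triple_points:
  assumes p: "p \<in> points" "q \<in> points" "r \<in> points"
    and rel: "point_rel p q" "point_rel q r" "point_rel p r"
  shows "dominated_triple p q r"
proof -
  obtain p' where p': "p' \<in> points" "\<And>w. w \<in> points \<Longrightarrow> point_rel w p \<Longrightarrow> point_rel w p'"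
    "(\<exists>v. p' = Inl v \<and> v \<in> V \<and> v \<notin> \<Union>sun_triangles) \<or> (\<exists>T\<in>sun_triangles. p' = Inr T)"
    using point_dominatedE[OF p(1)] by blast
  obtain q' where q': "q' \<in> points" "\<And>w. w \<in> points \<Longrightarrow> point_rel w q \<Longrightarrow> point_rel w q'"
    "(\<exists>v. q' = Inl v \<and> v \<in> V \<and> v \<notin> \<Union>sun_triangles) \<or> (\<exists>T\<in>sun_triangles. q' = Inr T)"
    using point_dominatedE[OF p(2)] by blast
  obtain r' where r': "r' \<in> points" "\<And>w. w \<in> points \<Longrightarrow> point_rel w r \<Longrightarrow> point_rel w r'"
    "(\<exists>v. r' = Inl v \<and> v \<in> V \<and> v \<notin> \<Union>sun_triangles) \<or> (\<exists>T\<in>sun_triangles. r' = Inr T)"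
    using point_dominatedE[OF p(3)] by blast
  have pq: "point_rel p' q'" by (meson p p' q' rel point_rel_sym)
  have qr: "point_rel q' r'" by (meson p q' r' rel point_rel_sym)
  have pr: "point_rel p' r'" by (meson p p' r' rel point_rel_sym)
  have "dominated_triple p' q' r'"
    using p'(3)
  proof (elim disjE exE conjE bexE)
    fix v assume v: "p' = Inl v" "v \<in> V" "v \<notin> \<Union>sun_triangles"
    show ?thesis using q'(3)
    proof (elim disjE exE conjE bexE)
      fix u assume u: "q' = Inl u" "u \<in> V" "u \<notin> \<Union>sun_triangles"
      show ?thesis using r'(3)
      proof (elim disjE exE conjE bexE)
        fix t assume t: "r' = Inl t" "t \<in> V" "t \<notin> \<Union>sun_triangles"
        show ?thesis using dominated_triple_vertices[of v u t] v u t pq qr pr by simp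
      next
        fix T assume T: "T \<in> sun_triangles" "r' = Inr T"
        have "dominated_triple (Inr T) (Inl v) (Inl u)"
          using dominated_triple_apex_vertex_vertex[OF T(1), of v u] v u T pq qr pr by simp
        then show ?thesis unfolding v u T by (rule dominated_triple_sym)
      qed
    next
      fix S assume S: "S \<in> sun_triangles" "q' = Inr S"
      show ?thesis using r'(3)
      proof (elim disjE exE conjE bexE)
        fix t assume t: "r' = Inl t" "t \<in> V" "t \<notin> \<Union>sun_triangles"
        have "dominated_triple (Inr S) (Inl v) (Inl t)"
          using dominated_triple_apex_vertex_vertex[OF S(1), of v t] v S t pq qr pr by simp
        then show ?thesis unfolding v S t by (rule dominated_triple_sym)
      next
        fix T assume T: "T \<in> sun_triangles" "r' = Inr T"
        have "dominated_triple (Inr S) (Inr T) (Inl v)"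
          using dominated_triple_apex_apex_vertex[OF S(1) T(1), of v] v S T pq qr pr by simp
        then show ?thesis unfolding v S T by (rule dominated_triple_sym(2)[OF dominated_triple_sym(2)])
      qed
    qed
  next
    fix P assume P: "P \<in> sun_triangles" "p' = Inr P"
    show ?thesis using q'(3)
    proof (elim disjE exE conjE bexE)
      fix u assume u: "q' = Inl u" "u \<in> V" "u \<notin> \<Union>sun_triangles"
      show ?thesis using r'(3)
      proof (elim disjE exE conjE bexE)
        fix t assume t: "r' = Inl t" "t \<in> V" "t \<notin> \<Union>sun_triangles"
        show ?thesis using dominated_triple_apex_vertex_vertex[OF P(1), of u t] P u t pq qr pr by simp
      next
        fix T assume T: "T \<in> sun_triangles" "r' = Inr T"
        have "dominated_triple (Inr T) (Inr P) (Inl u)"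
          using dominated_triple_apex_apex_vertex[OF T(1) P(1), of u] P u T pq qr pr joined_sym by simp
        then show ?thesis unfolding P u T by (rule dominated_triple_sym)
      qed
    next
      fix S assume S: "S \<in> sun_triangles" "q' = Inr S"
      show ?thesis using r'(3)
      proof (elim disjE exE conjE bexE)
        fix t assume t: "r' = Inl t" "t \<in> V" "t \<notin> \<Union>sun_triangles"
        show ?thesis using dominated_triple_apex_apex_vertex[OF P(1) S(1), of t] P S t pq qr pr by simp
      next
        fix T assume T: "T \<in> sun_triangles" "r' = Inr T"
        show ?thesis using dominated_triple_apex_apex_apex[OF P(1) S(1) T(1)] P S T pq qr pr by simp
      qed
    qed
  qed
  then show ?thesis
    using p'(2) q'(2) r'(2) unfolding extended_triangle_dominated_def by blast
qed

section \<open>Vertices of the second clique graph as points\<close>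

fun family :: "'a + 'a set \<Rightarrow> 'a set set" where
  "family (Inl v) = {Q \<in> maxcl V R. v \<in> Q}"
| "family (Inr T) = {Q \<in> maxcl V R. \<exists>s\<in>T. \<exists>t\<in>T. s \<noteq> t \<and> s \<in> Q \<and> t \<in> Q}"

lemma complete_in_cliqueE:
  assumes "S \<noteq> {}" "S \<subseteq> V" "\<And>x y. x \<in> S \<Longrightarrow> y \<in> S \<Longrightarrow> R x y"
  obtains Q where "Q \<in> maxcl V R" "S \<subseteq> Q"
  by (rule complete_extends_to_maxcl[of V R S]) (use fin R_sym assms in auto)

lemma sun_triangles_subset: "T \<in> sun_triangles \<Longrightarrow> T \<subseteq> V"
  unfolding sun_triangles_def using sun_in_V by blast

text \<open>The vertices of a common member are pairwise related. Conversely, the witnesses in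
  \<open>near\<close> and \<open>joined\<close> form a complete set, and a clique extending it is a
  common member.\<close>

lemma meets_family_iff:
  assumes "p \<in> points" "q \<in> points"
  shows "meets (family p) (family q) \<longleftrightarrow> point_rel p q"
proof -
  have VV: "meets (family (Inl u)) (family (Inl v)) \<longleftrightarrow> R u v" if uv: "u \<in> V" "v \<in> V" for u v
  proof
    assume "meets (family (Inl u)) (family (Inl v))"
    then obtain Q where "Q \<in> maxcl V R" "u \<in> Q" "v \<in> Q" by (auto simp: meets_def)
    then show "R u v" by (rule maxclD(3))
  next
    assume "R u v"
    then obtain Q where "Q \<in> maxcl V R" "{u, v} \<subseteq> Q"
      by (rule_tac complete_in_cliqueE[of "{u, v}"]) (use uv R_sym in auto)
    then show "meets (family (Inl u)) (family (Inl v))" by (auto simp: meets_def)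
  qed
  have VI: "meets (family (Inl v)) (family (Inr T)) \<longleftrightarrow> near v T" if T: "v \<in> V" "T \<in> sun_triangles" for v T
  proof
    assume "meets (family (Inl v)) (family (Inr T))"
    then obtain Q s t where "Q \<in> maxcl V R" "v \<in> Q" "s \<in> T" "t \<in> T" "s \<noteq> t" "s \<in> Q" "t \<in> Q"
      by (auto simp: meets_def)
    then show "near v T" unfolding near_def using maxclD(3)[of Q V R v] by blast
  next
    assume "near v T"
    then obtain s t where st: "s \<in> T" "t \<in> T" "s \<noteq> t" "R v s" "R v t" unfolding near_def by blast
    have "R s t" using sun_triangles_E[OF T(2)] st by blast
    then obtain Q where "Q \<in> maxcl V R" "{v, s, t} \<subseteq> Q"
      by (rule_tac complete_in_cliqueE[of "{v, s, t}"])
        (use st T(1) R_sym sun_triangles_subset[OF T(2)] in auto)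
    then have "Q \<in> family (Inl v) \<inter> family (Inr T)" using st by auto
    then show "meets (family (Inl v)) (family (Inr T))" unfolding meets_def by blast
  qed
  have II: "meets (family (Inr T)) (family (Inr S)) \<longleftrightarrow> joined T S"
    if T: "T \<in> sun_triangles" "S \<in> sun_triangles" for T S
  proof
    assume "meets (family (Inr T)) (family (Inr S))"
    then obtain Q s t p q where Q: "Q \<in> maxcl V R" and "s \<in> T" "t \<in> T" "s \<noteq> t" "s \<in> Q" "t \<in> Q"
      "p \<in> S" "q \<in> S" "p \<noteq> q" "p \<in> Q" "q \<in> Q"
      by (auto simp: meets_def)
    then show "joined T S" using joinedI[of s T t p S q] maxclD(3)[OF Q] by simp
  next
    assume "joined T S"
    then obtain s t p q where st: "s \<in> T" "t \<in> T" "p \<in> S" "q \<in> S" "s \<noteq> t" "p \<noteq> q"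
      "R s p" "R s q" "R t p" "R t q"
      unfolding joined_def by blast
    have "R s t" "R p q" using sun_triangles_E[OF T(1)] sun_triangles_E[OF T(2)] st by blast+
    then obtain Q where "Q \<in> maxcl V R" "{s, t, p, q} \<subseteq> Q"
      by (rule_tac complete_in_cliqueE[of "{s, t, p, q}"])
        (use st R_sym sun_triangles_subset[OF T(1)] sun_triangles_subset[OF T(2)] in auto)
    then have "Q \<in> family (Inr T) \<inter> family (Inr S)" using st by auto
    then show "meets (family (Inr T)) (family (Inr S))" unfolding meets_def by blast
  qed
  have sym: "meets A B \<longleftrightarrow> meets B A" for A B :: "'a set set" by (auto simp: meets_def)
  show ?thesis
    using assms VV VI II sym[of "family (Inr _)" "family (Inl _)"]
    by (cases p; cases q) (auto simp: points_def simp del: family.simps)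
qed

text \<open>For a triangle: two pairs inside a three-element set overlap.\<close>

lemma family_pairwise_meets:
  assumes "p \<in> points" "P \<in> family p" "Q \<in> family p"
  shows "meets P Q"
proof (cases p)
  case (Inl v) then show ?thesis using assms by (auto simp: meets_def)
next
  case (Inr T)
  then obtain a b c where T: "T = {a, b, c}" using assms(1) by (auto simp: points_def sun_triangles_def)
  obtain s t s' t' where "s \<in> T" "t \<in> T" "s \<noteq> t" "s \<in> P" "t \<in> P" "s' \<in> T" "t' \<in> T" "s' \<noteq> t'" "s' \<in> Q" "t' \<in> Q"
    using assms Inr by auto
  moreover from this have "s = s' \<or> s = t' \<or> t = s' \<or> t = t'" unfolding T by blast
  ultimately show ?thesis unfolding meets_def by blast
qed

lemma family_subset: "family p \<subseteq> maxcl V R"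
  by (cases p) auto

text \<open>If \<open>F\<close> has a common vertex, that vertex is the point. Otherwise the
  triangle from \<open>intersecting_maxcl_cases\<close> turns out to be the centre of a sun, and
  every member of \<open>F\<close> has two vertices in it.\<close>

lemma maxcl_meets_is_family:
  assumes F: "F \<in> maxcl (maxcl V R) meets"
  obtains p where "p \<in> points" "F = family p"
proof -
  note F' = maxclD[OF F] and result = that
  \<comment> \<open>By maximality of \<open>F\<close>, inclusion in a pairwise meeting family is
    equality.\<close>
  have sub: thesis if p: "p \<in> points" "F \<subseteq> family p" for p
  proof -
    have "Q \<in> F" if "Q \<in> family p" for Q
      using F'(4)[of Q] family_pairwise_meets[OF p(1) that] p(2) that family_subset by blast
    then show thesis using p result[of p] by blast
  qed
  have "finite F" using F'(2) finite_maxcl[OF fin] finite_subset by blast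
  then show thesis
  proof (rule intersecting_maxcl_cases[OF _ F'(1,2,3)])
    fix v assume v: "v \<in> \<Inter>F"
    obtain Q where Q: "Q \<in> F" using F'(1) by blast
    then have "v \<in> V" using v F'(2) maxclD(2)[of Q V R] by blast
    then show thesis using sub[of "Inl v"] v F'(2) by (auto simp: points_def)
  next
    fix M a b c
    assume M: "M \<subseteq> F" "\<Inter>M = {}" "M \<noteq> {}" and abc: "R a b" "R b c" "R a c" "a \<in> V" "b \<in> V" "c \<in> V"
      and two: "\<And>Q. Q \<in> M \<Longrightarrow> a \<in> Q \<and> b \<in> Q \<or> b \<in> Q \<and> c \<in> Q \<or> a \<in> Q \<and> c \<in> Q"
    \<comment> \<open>Some member of \<open>M\<close> misses \<open>v\<close>, and by maximality it
      contains a vertex unrelated to \<open>v\<close>. For \<open>a\<close>, \<open>b\<close>,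
      \<open>c\<close> these vertices become the outer vertices of the sun.\<close>
    have pick: "\<exists>Q x. Q \<in> M \<and> x \<in> Q \<and> v \<notin> Q \<and> \<not> R x v \<and> Q \<in> maxcl V R" if v: "v \<in> V" for v
    proof -
      obtain Q where Q: "Q \<in> M" "v \<notin> Q" using M(2) by blast
      then have cl: "Q \<in> maxcl V R" using M F'(2) by blast
      then obtain x where "x \<in> Q" "\<not> R v x" using maxclD(4)[OF cl v] Q by blast
      then show ?thesis using Q cl R_sym by blast
    qed
    obtain A x where A: "A \<in> M" "x \<in> A" "a \<notin> A" "\<not> R x a" "A \<in> maxcl V R" using pick[OF abc(4)] by blast
    obtain B y where B: "B \<in> M" "y \<in> B" "b \<notin> B" "\<not> R y b" "B \<in> maxcl V R" using pick[OF abc(5)] by blast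
    obtain C z where C: "C \<in> M" "z \<in> C" "c \<notin> C" "\<not> R z c" "C \<in> maxcl V R" using pick[OF abc(6)] by blast
    have mem: "b \<in> A" "c \<in> A" "a \<in> B" "c \<in> B" "a \<in> C" "b \<in> C"
      using two[OF A(1)] two[OF B(1)] two[OF C(1)] A B C by blast+
    have ne: "a \<noteq> b" "b \<noteq> c" "a \<noteq> c" using mem A B C by blast+
    have RR: "R x b" "R x c" "R y a" "R y c" "R z a" "R z b"
      using mem A B C maxclD(3) by metis+
    have xe: "E x b" "E x c" "E y a" "E y c" "E z a" "E z b"
      using RR A(4) B(4) C(4) abc R_sym unfolding R_def by blast+
    have s: "sun a b c x y z" unfolding sun_def using abc ne xe A(4) B(4) C(4) by (auto simp: R_def)
    note n = sun_nbrs[OF s]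
    have Asub: "A \<subseteq> {b, c, x}"
    proof
      fix v assume v: "v \<in> A"
      then have "R b v" "R c v" using mem A(5) maxclD(3) by metis+
      then show "v \<in> {b, c, x}" using n(2,3)[of v] v A(3) sun_distinct[OF s] by (auto simp: R_def)
    qed
    have Bsub: "B \<subseteq> {a, c, y}"
    proof
      fix v assume v: "v \<in> B"
      then have "R a v" "R c v" using mem B(5) maxclD(3) by metis+
      then show "v \<in> {a, c, y}" using n(1,3)[of v] v B(3) sun_distinct[OF s] by (auto simp: R_def)
    qed
    have Csub: "C \<subseteq> {a, b, z}"
    proof
      fix v assume v: "v \<in> C"
      then have "R a v" "R b v" using mem C(5) maxclD(3) by metis+
      then show "v \<in> {a, b, z}" using n(1,2)[of v] v C(3) sun_distinct[OF s] by (auto simp: R_def)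
    qed
    have "Q \<in> family (Inr {a, b, c})" if Q: "Q \<in> F" for Q
    proof -
      have cl: "Q \<in> maxcl V R" using Q F'(2) by blast
      note RQ = maxclD(3)[OF cl]
      \<comment> \<open>If \<open>Q\<close> contained none of \<open>a\<close>, \<open>b\<close>,
        \<open>c\<close>, meeting \<open>A\<close>, \<open>B\<close>, \<open>C\<close> would put
        \<open>x\<close>, \<open>y\<close>, \<open>z\<close> into \<open>Q\<close> and give an
        octahedron. If it contained only \<open>a\<close>, meeting \<open>A\<close> would put
        \<open>x\<close> into \<open>Q\<close>, which is unrelated to \<open>a\<close>; similarly
        for \<open>b\<close> and \<open>c\<close>.\<close>
      have "meets Q A" "meets Q B" "meets Q C" using F'(3)[OF Q] A B C M(1) by blast+
      then have m: "b \<in> Q \<or> c \<in> Q \<or> x \<in> Q" "a \<in> Q \<or> c \<in> Q \<or> y \<in> Q" "a \<in> Q \<or> b \<in> Q \<or> z \<in> Q"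
        using Asub Bsub Csub unfolding meets_def by blast+
      have "\<not> (x \<in> Q \<and> y \<in> Q \<and> z \<in> Q)"
      proof
        assume "x \<in> Q \<and> y \<in> Q \<and> z \<in> Q"
        then have "R x y" "R y z" "R x z" using RQ by blast+
        then show False using sun_not_octahedral[OF s] sun_distinct[OF s] by (auto simp: R_def)
      qed
      moreover have "\<not> (x \<in> Q \<and> a \<in> Q)" "\<not> (y \<in> Q \<and> b \<in> Q)" "\<not> (z \<in> Q \<and> c \<in> Q)"
        using RQ A(4) B(4) C(4) by blast+
      ultimately have "a \<in> Q \<and> b \<in> Q \<or> b \<in> Q \<and> c \<in> Q \<or> a \<in> Q \<and> c \<in> Q" using m by argo
      then show ?thesis using cl ne by auto
    qed
    then show thesis using sub[of "Inr {a, b, c}"] sun_in_triangles[OF s] by (auto simp: points_def)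
  qed auto
qed

theorem clique_Helly_second_clique_graph: "clique_Helly (maxcl (maxcl V R) meets) meets"
proof (rule clique_Helly_triangles)
  let ?C = "maxcl V R" and ?J = "maxcl (maxcl V R) meets"
  show "finite ?J" using finite_maxcl finite_maxcl[OF fin] by blast
  show "meets y x" if "meets x y" for x y :: "'a set set" using that by (auto simp: meets_def)
  fix X Y Z assume J: "X \<in> ?J" "Y \<in> ?J" "Z \<in> ?J" and m: "meets X Y" "meets Y Z" "meets X Z"
  obtain p where p: "p \<in> points" "X = family p" using maxcl_meets_is_family[OF J(1)] .
  obtain q where q: "q \<in> points" "Y = family q" using maxcl_meets_is_family[OF J(2)] .
  obtain r where r: "r \<in> points" "Z = family r" using maxcl_meets_is_family[OF J(3)] .
  have "dominated_triple p q r"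
    using dominated_triple_points[OF p(1) q(1) r(1)] meets_family_iff m p q r by blast
  then obtain u where u: "u \<in> points" "\<And>w. w \<in> points \<Longrightarrow>
      point_rel w p \<and> point_rel w q \<or> point_rel w q \<and> point_rel w r \<or> point_rel w p \<and> point_rel w r \<Longrightarrow> point_rel w u"
    unfolding extended_triangle_dominated_def by blast
  have "meets (family u) (family u)" using meets_family_iff[OF u(1) u(1)] point_rel_refl[OF u(1)] by simp
  then have ne: "family u \<noteq> {}" by (auto simp: meets_def)
  have refl: "meets Q Q" if "Q \<in> ?C" for Q using maxclD(1)[OF that] by (auto simp: meets_def)
  have sym: "meets Q P" if "meets P Q" for P Q :: "'a set" using that by (auto simp: meets_def)
  \<comment> \<open>\<open>family u\<close> need not be maximal, so it is enlarged to a vertex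
    \<open>U\<close> of the second clique graph; whatever meets \<open>family u\<close> also meets
    \<open>U\<close>.\<close>
  obtain U where U: "U \<in> ?J" "family u \<subseteq> U"
    by (rule complete_extends_to_maxcl[OF finite_maxcl[OF fin] refl sym ne family_subset
          family_pairwise_meets[OF u(1)]])
  show "extended_triangle_dominated ?J meets X Y Z"
    unfolding extended_triangle_dominated_def
  proof (intro bexI[OF _ U(1)] ballI impI)
    fix W assume W: "W \<in> ?J" "meets W X \<and> meets W Y \<or> meets W Y \<and> meets W Z \<or> meets W X \<and> meets W Z"
    obtain w where w: "w \<in> points" "W = family w" using maxcl_meets_is_family[OF W(1)] .
    have "point_rel w u" using u(2)[OF w(1)] W(2) meets_family_iff w p q r by simp
    then have "meets W (family u)" using meets_family_iff[OF w(1) u(1)] w by simp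
    then show "meets W U" using U(2) by (auto simp: meets_def)
  qed
qed

end

section \<open>Iterated clique graphs\<close>

definition closed_adj :: "'a pair_pre_digraph \<Rightarrow> 'a \<Rightarrow> 'a \<Rightarrow> bool" where
  "closed_adj G u v \<longleftrightarrow> u = v \<or> (u, v) \<in> parcs G"

definition Helly_graph :: "'a pair_pre_digraph \<Rightarrow> bool" where
  "Helly_graph G \<longleftrightarrow> clique_Helly (pverts G) (closed_adj G)"

lemma pair_graphD:
  assumes "pair_graph G"
  shows "finite (pverts G)" "pair_wf_digraph G" "(u, v) \<in> parcs G \<Longrightarrow> (v, u) \<in> parcs G"
    "(u, v) \<in> parcs G \<Longrightarrow> u \<in> pverts G" "(u, v) \<in> parcs G \<Longrightarrow> v \<in> pverts G" "(v, v) \<notin> parcs G"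
proof -
  interpret pair_graph G by (rule assms)
  show "finite (pverts G)" "pair_wf_digraph G" by (rule pair_finite_verts) unfold_locales
  show "(u, v) \<in> parcs G \<Longrightarrow> (v, u) \<in> parcs G"
    using pair_sym_arcs by (auto simp: symmetric_def dest: symD)
  show "(u, v) \<in> parcs G \<Longrightarrow> u \<in> pverts G" "(u, v) \<in> parcs G \<Longrightarrow> v \<in> pverts G"
    by (auto dest: in_arcsD1 in_arcsD2)
  show "(v, v) \<notin> parcs G" using pair_no_loops by fastforce
qed

lemma pair_graphI:
  assumes "finite (pverts G)" "\<And>u v. (u, v) \<in> parcs G \<Longrightarrow> u \<in> pverts G \<and> v \<in> pverts G \<and> u \<noteq> v \<and> (v, u) \<in> parcs G"
  shows "pair_graph G"
proof -
  have "finite (parcs G)"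
    by (rule finite_subset[of _ "pverts G \<times> pverts G"]) (use assms in auto)
  then show ?thesis
    by unfold_locales (use assms in \<open>auto simp: symmetric_def intro!: symI\<close>)
qed

lemma closed_adj_sym: "pair_graph G \<Longrightarrow> closed_adj G u v \<Longrightarrow> closed_adj G v u"
  unfolding closed_adj_def by (metis pair_graphD(3))

text \<open>Maximality can be tested by adding single vertices, since a larger complete set contains
  a vertex outside \<open>S\<close> related to all of \<open>S\<close>.\<close>

lemma cliques_eq_maxcl:
  assumes G: "pair_graph G"
  shows "cliques G = maxcl (pverts G) (closed_adj G)"
proof (intro subset_antisym subsetI)
  note G' = pair_graphD[OF G]
  fix S assume "S \<in> cliques G"
  then have S: "S \<noteq> {}" "finite S" "S \<subseteq> pverts G" "\<And>u v. u \<in> S \<Longrightarrow> v \<in> S \<Longrightarrow> u \<noteq> v \<Longrightarrow> (u, v) \<in> parcs G"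
    "\<And>T. finite T \<Longrightarrow> S \<subset> T \<Longrightarrow> T \<subseteq> pverts G \<Longrightarrow> \<exists>u\<in>T. \<exists>v\<in>T. u \<noteq> v \<and> (u, v) \<notin> parcs G"
    unfolding cliques_conv[OF G'(2)] by blast+
  have "v \<in> S" if v: "v \<in> pverts G" "\<forall>x\<in>S. closed_adj G v x" for v
  proof (rule ccontr)
    assume "v \<notin> S"
    then have nb: "(v, x) \<in> parcs G" "(x, v) \<in> parcs G" if "x \<in> S" for x
      using v that G'(3) by (auto simp: closed_adj_def)
    have "\<exists>u\<in>insert v S. \<exists>w\<in>insert v S. u \<noteq> w \<and> (u, w) \<notin> parcs G"
      by (rule S(5)) (use S v \<open>v \<notin> S\<close> in auto)
    then show False using nb S(4) by blast
  qed
  then show "S \<in> maxcl (pverts G) (closed_adj G)" using S by (auto simp: maxcl_def closed_adj_def)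
next
  note G' = pair_graphD[OF G]
  fix S assume "S \<in> maxcl (pverts G) (closed_adj G)"
  note S = maxclD[OF this]
  have "finite S" using S(2) G'(1) finite_subset by blast
  moreover have "\<exists>u\<in>T. \<exists>v\<in>T. u \<noteq> v \<and> (u, v) \<notin> parcs G" if T: "S \<subset> T" "T \<subseteq> pverts G" for T
  proof (rule ccontr)
    assume c: "\<not> ?thesis"
    obtain v where v: "v \<in> T" "v \<notin> S" using T by blast
    then have "v \<in> S" using S(4)[of v] c T by (auto simp: closed_adj_def)
    then show False using v by simp
  qed
  ultimately show "S \<in> cliques G"
    unfolding cliques_conv[OF G'(2)] using S(1,2,3) by (auto simp: closed_adj_def)
qed

lemma pair_graph_clique_graph:
  assumes "pair_graph G"
  shows "pair_graph (clique_graph G)"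
  by (rule pair_graphI)
    (use cliques_eq_maxcl[OF assms] finite_maxcl[OF pair_graphD(1)[OF assms]] in \<open>auto simp: clique_graph_def\<close>)

text \<open>Cliques are nonempty, so \<open>meets\<close> also covers the case
  \<open>S = T\<close>.\<close>

lemma closed_adj_clique_graph:
  assumes "pair_graph G" "S \<in> cliques G" "T \<in> cliques G"
  shows "closed_adj (clique_graph G) S T \<longleftrightarrow> meets S T"
  using assms maxclD(1)[of S] by (auto simp: closed_adj_def clique_graph_def meets_def cliques_eq_maxcl)

lemma cliques_clique_graph:
  assumes "pair_graph G"
  shows "cliques (clique_graph G) = maxcl (cliques G) meets"
  unfolding cliques_eq_maxcl[OF pair_graph_clique_graph[OF assms]]
  using maxcl_cong[of "cliques G" "closed_adj (clique_graph G)" meets] closed_adj_clique_graph[OF assms]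
  by (simp add: clique_graph_def)

lemma Helly_graph_clique_graph_iff:
  assumes "pair_graph G"
  shows "Helly_graph (clique_graph G) \<longleftrightarrow> clique_Helly (cliques G) meets"
proof -
  have "maxcl (pverts (clique_graph G)) (closed_adj (clique_graph G)) = maxcl (cliques G) meets"
    using cliques_clique_graph[OF assms] cliques_eq_maxcl[OF pair_graph_clique_graph[OF assms]] by simp
  then show ?thesis unfolding Helly_graph_def clique_Helly_def by simp
qed

lemma Helly_graph_clique_graph:
  assumes G: "pair_graph G" "Helly_graph G"
  shows "Helly_graph (clique_graph G)"
  unfolding Helly_graph_clique_graph_iff[OF G(1)] cliques_eq_maxcl[OF G(1)]
  by (rule clique_Helly_maxcl)
    (use G pair_graphD(1)[OF G(1)] closed_adj_sym[OF G(1)] in \<open>auto simp: Helly_graph_def closed_adj_def\<close>)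

lemma card_cliques_clique_graph_le:
  assumes "pair_graph G" "Helly_graph G"
  shows "card (cliques (clique_graph G)) \<le> card (pverts G)"
  using card_maxcl_maxcl_le[OF pair_graphD(1)[OF assms(1)]] assms
  by (simp add: cliques_clique_graph cliques_eq_maxcl Helly_graph_def)

section \<open>Invariance under relabelling\<close>

lemma closed_adj_relabel:
  assumes "pair_graph G" "inj_on f (pverts G)" "u \<in> pverts G" "v \<in> pverts G"
  shows "closed_adj (relabel f G) (f u) (f v) \<longleftrightarrow> closed_adj G u v"
proof -
  have "(u, v) \<in> parcs G" if "(u', v') \<in> parcs G" "f u = f u'" "f v = f v'" for u' v'
    using that assms pair_graphD(4,5)[OF assms(1) that(1)] by (metis inj_onD)
  then have "(f u, f v) \<in> map_prod f f ` parcs G \<longleftrightarrow> (u, v) \<in> parcs G" by auto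
  then show ?thesis
    using assms(2-4) by (auto simp: closed_adj_def relabel_def inj_on_eq_iff)
qed

lemma pair_graph_relabel:
  assumes G: "pair_graph G" and inj: "inj_on f (pverts G)"
  shows "pair_graph (relabel f G)"
proof (rule pair_graphI)
  show "finite (pverts (relabel f G))" using pair_graphD(1)[OF G] by (simp add: relabel_def)
  fix u v assume "(u, v) \<in> parcs (relabel f G)"
  then obtain u' v' where uv: "(u', v') \<in> parcs G" "u = f u'" "v = f v'" by (auto simp: relabel_def)
  note D = pair_graphD(3-6)[OF G]
  have "u' \<noteq> v'" using uv D(4) by blast
  then have "u \<noteq> v" using uv D(2,3)[OF uv(1)] inj by (auto simp: inj_on_eq_iff)
  moreover have "(v, u) \<in> parcs (relabel f G)" using D(1)[OF uv(1)] uv by (force simp: relabel_def)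
  ultimately show "u \<in> pverts (relabel f G) \<and> v \<in> pverts (relabel f G) \<and> u \<noteq> v \<and> (v, u) \<in> parcs (relabel f G)"
    using D(2,3)[OF uv(1)] uv by (auto simp: relabel_def)
qed

lemma maxcl_image:
  assumes "\<And>x y. x \<in> V \<Longrightarrow> y \<in> V \<Longrightarrow> R' (f x) (f y) \<longleftrightarrow> R x y" and inj: "inj_on f V"
  shows "maxcl (f ` V) R' = image f ` maxcl V R"
proof -
  have *: "f ` S \<in> maxcl (f ` V) R' \<longleftrightarrow> S \<in> maxcl V R" if S: "S \<subseteq> V" for S
  proof -
    have "(\<forall>x\<in>f ` S. \<forall>y\<in>f ` S. R' x y) \<longleftrightarrow> (\<forall>x\<in>S. \<forall>y\<in>S. R x y)"
      using assms(1) S by (simp add: subset_iff)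
    moreover have "(\<forall>v\<in>f ` V. (\<forall>x\<in>f ` S. R' v x) \<longrightarrow> v \<in> f ` S) \<longleftrightarrow> (\<forall>v\<in>V. (\<forall>x\<in>S. R v x) \<longrightarrow> v \<in> S)"
      using assms(1) S inj_on_image_mem_iff[OF inj _ S] by (simp add: subset_iff)
    ultimately show ?thesis using S by (auto simp: maxcl_def)
  qed
  show ?thesis
  proof (intro subset_antisym subsetI)
    fix S' assume S': "S' \<in> maxcl (f ` V) R'"
    then obtain S where "S \<subseteq> V" "S' = f ` S" using maxclD(2)[OF S'] by (auto simp: subset_image_iff)
    then show "S' \<in> image f ` maxcl V R" using * S' by auto
  next
    fix S' assume "S' \<in> image f ` maxcl V R"
    then show "S' \<in> maxcl (f ` V) R'" using * maxclD(2) by blast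
  qed
qed

lemma cliques_relabel:
  assumes "pair_graph G" "inj_on f (pverts G)"
  shows "cliques (relabel f G) = image f ` cliques G"
  unfolding cliques_eq_maxcl[OF assms(1)] cliques_eq_maxcl[OF pair_graph_relabel[OF assms]]
  using maxcl_image[of "pverts G" "closed_adj (relabel f G)" f "closed_adj G"] closed_adj_relabel[OF assms] assms(2)
  by (simp add: relabel_def)

lemma inj_on_image_cliques:
  assumes "pair_graph G" "inj_on f (pverts G)"
  shows "inj_on (image f) (cliques G)"
  using inj_on_subset[OF inj_on_image_Pow[OF assms(2)]] maxclD(2) cliques_eq_maxcl[OF assms(1)] by blast

lemma clique_graph_relabel:
  assumes G: "pair_graph G" "inj_on f (pverts G)"
  shows "clique_graph (relabel f G) = relabel (image f) (clique_graph G)"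
proof -
  have sub: "S \<subseteq> pverts G" if "S \<in> cliques G" for S
    using that maxclD(2) cliques_eq_maxcl[OF G(1)] by blast
  have int: "f ` S \<inter> f ` T \<noteq> {} \<longleftrightarrow> S \<inter> T \<noteq> {}" if "S \<in> cliques G" "T \<in> cliques G" for S T
    using inj_on_image_Int[OF G(2) sub[OF that(1)] sub[OF that(2)]] by auto
  have ne: "f ` S \<noteq> f ` T \<longleftrightarrow> S \<noteq> T" if "S \<in> cliques G" "T \<in> cliques G" for S T
    using inj_onD[OF inj_on_image_cliques[OF G]] that by blast
  have "parcs (clique_graph (relabel f G)) = map_prod (image f) (image f) ` parcs (clique_graph G)"
    (is "?L = ?M")
  proof (intro subset_antisym subsetI)
    fix e assume e: "e \<in> ?L"
    obtain A B where AB: "e = (A, B)" by (cases e)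
    then have "A \<in> image f ` cliques G" "B \<in> image f ` cliques G" "A \<noteq> B" "A \<inter> B \<noteq> {}"
      using e by (simp_all add: clique_graph_def flip: cliques_relabel[OF G])
    with AB obtain S T where "e = (f ` S, f ` T)" "S \<in> cliques G" "T \<in> cliques G" "f ` S \<noteq> f ` T" "f ` S \<inter> f ` T \<noteq> {}"
      by blast
    then have "e = map_prod (image f) (image f) (S, T)" "(S, T) \<in> parcs (clique_graph G)"
      using int ne by (auto simp: clique_graph_def)
    then show "e \<in> ?M" by blast
  next
    fix e assume "e \<in> ?M"
    then obtain S T where "e = (f ` S, f ` T)" "S \<in> cliques G" "T \<in> cliques G" "S \<noteq> T" "S \<inter> T \<noteq> {}"
      by (auto simp: clique_graph_def)
    then show "e \<in> ?L" using int ne by (simp add: clique_graph_def cliques_relabel[OF G])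
  qed
  moreover have "pverts (clique_graph (relabel f G)) = image f ` pverts (clique_graph G)"
    by (simp add: clique_graph_def cliques_relabel[OF G])
  ultimately show ?thesis by (simp add: relabel_def)
qed

lemma Helly_graph_relabel:
  assumes G: "pair_graph G" "inj_on f (pverts G)" and H: "Helly_graph G"
  shows "Helly_graph (relabel f G)"
  unfolding Helly_graph_def clique_Helly_def cliques_eq_maxcl[OF pair_graph_relabel[OF G(1,2)], symmetric]
    cliques_relabel[OF G]
proof (intro allI impI)
  fix F assume F: "F \<noteq> {} \<and> F \<subseteq> image f ` cliques G \<and> (\<forall>S\<in>F. \<forall>T\<in>F. meets S T)"
  then obtain F' where F': "F' \<subseteq> cliques G" "F = image f ` F'" by (auto simp: subset_image_iff)
  have "meets S T" if "S \<in> F'" "T \<in> F'" for S T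
  proof -
    have "S \<subseteq> pverts G" "T \<subseteq> pverts G"
      using that F' maxclD(2) cliques_eq_maxcl[OF G(1)] by blast+
    moreover have "f ` S \<inter> f ` T \<noteq> {}" using F F' that by (auto simp: meets_def)
    ultimately show ?thesis using inj_on_image_Int[OF G(2), of S T] by (auto simp: meets_def)
  qed
  moreover have "F' \<noteq> {}" using F F' by auto
  ultimately have "\<Inter>F' \<noteq> {}"
    using H[unfolded Helly_graph_def clique_Helly_def cliques_eq_maxcl[OF G(1), symmetric], rule_format, of F'] F'(1)
    by simp
  then show "\<Inter>F \<noteq> {}" using F' by auto
qed

lemma relabel_relabel: "relabel g (relabel f G) = relabel (g \<circ> f) G"
  by (simp add: relabel_def image_comp map_prod.comp)

section \<open>The sequence of iterates\<close>

lemma inj_on_Clique: "inj_on (\<lambda>S. Clique (Abs_fset S)) (pverts (clique_graph G))"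
  by (auto intro!: inj_onI simp: clique_graph_def Abs_fset_inject finite_clique)

lemma pair_graph_iterated:
  assumes "pair_graph G"
  shows "pair_graph (iterated_clique_graph n G)"
proof (induction n)
  case 0 show ?case using pair_graph_relabel[OF assms, of Base] by (simp add: inj_on_def)
next
  case (Suc n) then show ?case
    using pair_graph_relabel[OF pair_graph_clique_graph[OF Suc] inj_on_Clique] by simp
qed

text \<open>The second iterate is a relabelling of the clique graph of the clique graph, and
  relabelling preserves the Helly property.\<close>

lemma iterated_2_Helly:
  assumes G: "pair_graph G" and H: "Helly_graph (clique_graph (clique_graph G))"
  shows "Helly_graph (iterated_clique_graph 2 G)"
proof -
  let ?c = "\<lambda>S. Clique (Abs_fset S) :: 'a clique_vertex"
  have inj: "inj_on Base (pverts G)" by (simp add: inj_on_def)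
  \<comment> \<open>A clique is renamed in two stages: its vertices by \<open>Base\<close>, then the
    resulting set by \<open>Clique\<close>.\<close>
  let ?f = "?c \<circ> image Base"
  have "iterated_clique_graph 1 G = relabel ?f (clique_graph G)"
    by (simp add: clique_graph_relabel[OF G inj] relabel_relabel)
  moreover have f: "inj_on ?f (pverts (clique_graph G))"
    using comp_inj_on[OF inj_on_image_cliques[OF G inj], of ?c] inj_on_Clique[of "relabel Base G"]
    by (simp add: clique_graph_def cliques_relabel[OF G inj])
  ultimately have eq: "clique_graph (iterated_clique_graph 1 G) = relabel (image ?f) (clique_graph (clique_graph G))"
    using clique_graph_relabel[OF pair_graph_clique_graph[OF G] f] by simp
  have "Helly_graph (clique_graph (iterated_clique_graph 1 G))"
    unfolding eq
    by (rule Helly_graph_relabel[OF pair_graph_clique_graph[OF pair_graph_clique_graph[OF G]] _ H])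
      (use inj_on_image_cliques[OF pair_graph_clique_graph[OF G] f] in \<open>simp add: clique_graph_def\<close>)
  then show ?thesis
    using Helly_graph_relabel[OF pair_graph_clique_graph[OF pair_graph_iterated[OF G]] inj_on_Clique, of 1]
    by (simp add: numeral_2_eq_2)
qed

lemma iterated_Helly_Suc:
  assumes "pair_graph G" "Helly_graph (iterated_clique_graph n G)"
  shows "Helly_graph (iterated_clique_graph (Suc n) G)"
  using Helly_graph_relabel[OF pair_graph_clique_graph[OF pair_graph_iterated[OF assms(1)]] inj_on_Clique]
    Helly_graph_clique_graph[OF pair_graph_iterated[OF assms(1)] assms(2)] by simp

lemma card_iterated_le:
  assumes G: "pair_graph G" and H: "Helly_graph (iterated_clique_graph n G)"
  shows "card (pverts (iterated_clique_graph (Suc (Suc n)) G)) \<le> card (pverts (iterated_clique_graph n G))"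
proof -
  let ?I = "iterated_clique_graph n G" and ?c = "\<lambda>S. Clique (Abs_fset S) :: 'a clique_vertex"
  note I = pair_graph_iterated[OF G, of n]
  have fin: "finite (cliques (clique_graph ?I))"
    using pair_graphD(1)[OF pair_graph_clique_graph[OF pair_graph_clique_graph[OF I]]]
    by (simp add: clique_graph_def)
  have "pverts (iterated_clique_graph (Suc (Suc n)) G) = ?c ` image ?c ` cliques (clique_graph ?I)"
    using cliques_relabel[OF pair_graph_clique_graph[OF I] inj_on_Clique]
    by (simp add: relabel_def clique_graph_def)
  then have "card (pverts (iterated_clique_graph (Suc (Suc n)) G)) \<le> card (cliques (clique_graph ?I))"
    using card_image_le[OF fin] card_image_le[OF finite_imageI[OF fin]] by (metis (no_types, lifting) order_trans)
  also have "\<dots> \<le> card (pverts ?I)" by (rule card_cliques_clique_graph_le[OF I H])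
  finally show ?thesis .
qed

lemma digraph_iso_of_relabel_eq:
  assumes "pair_graph G" "pair_graph H" "inj_on f (pverts G)" "inj_on g (pverts H)" "relabel f G = relabel g H"
  shows "digraph_iso (with_proj G) (with_proj H)"
proof -
  have "digraph_iso (with_proj H) (with_proj (relabel f G))"
    using relabel_iso[OF pair_graphD(2)[OF assms(2)] assms(4)] assms(5) by simp
  moreover have "wf_digraph (with_proj H)"
  proof -
    interpret pair_wf_digraph H by (rule pair_graphD(2)[OF assms(2)])
    show ?thesis by (rule wf_digraph)
  qed
  ultimately have "digraph_iso (with_proj (relabel f G)) (with_proj H)" by (rule digraph_iso_swap[rotated])
  then show ?thesis by (rule digraph_iso_trans[OF relabel_iso[OF pair_graphD(2)[OF assms(1)] assms(3)]])
qed

text \<open>Pigeonhole: each graph is copied onto an initial segment of the naturals, and only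
  finitely many graphs have all their vertices below \<open>N\<close>. Equal copies come from
  isomorphic graphs.\<close>

lemma bounded_order_iso:
  fixes I :: "nat \<Rightarrow> 'a pair_pre_digraph"
  assumes I: "\<And>n. pair_graph (I n)" and card: "\<And>n. card (pverts (I n)) \<le> N"
  obtains m n where "m < n" "digraph_iso (with_proj (I m)) (with_proj (I n))"
proof -
  have "\<exists>f. bij_betw f (pverts (I n)) {..<card (pverts (I n))}" for n
    using ex_bij_betw_finite_nat[OF pair_graphD(1)[OF I]] by (simp add: atLeast0LessThan)
  then obtain f where f: "\<And>n. bij_betw (f n) (pverts (I n)) {..<card (pverts (I n))}" by metis
  define c where "c n = (pverts (relabel (f n) (I n)), parcs (relabel (f n) (I n)))" for n
  have sub: "c n \<in> Pow {..<N} \<times> Pow ({..<N} \<times> {..<N})" for n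
  proof -
    have V: "pverts (relabel (f n) (I n)) \<subseteq> {..<N}"
      using f[of n] card[of n] by (auto simp: relabel_def bij_betw_def)
    have "parcs (relabel (f n) (I n)) \<subseteq> pverts (relabel (f n) (I n)) \<times> pverts (relabel (f n) (I n))"
      using pair_graphD(4,5)[OF I[of n]] by (auto simp: relabel_def)
    then show ?thesis using V unfolding c_def by blast
  qed
  have "range c \<subseteq> Pow {..<N} \<times> Pow ({..<N} \<times> {..<N})" using sub by blast
  then have "finite (range c)" by (rule finite_subset) simp
  then have "\<not> inj c" using finite_imageD[of c UNIV] by auto
  then obtain m n where "c m = c n" "m \<noteq> n" by (auto simp: inj_def)
  then obtain m n where mn: "m < n" "c m = c n" by (metis nat_neq_iff)
  have "relabel (f m) (I m) = relabel (f n) (I n)" using mn(2) by (simp add: c_def relabel_def)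
  then have "digraph_iso (with_proj (I m)) (with_proj (I n))"
    using digraph_iso_of_relabel_eq[OF I I] f bij_betw_imp_inj_on by blast
  then show thesis using that mn by blast
qed

lemma convergent_if_second_clique_graph_Helly:
  assumes G: "pair_graph G" and H: "Helly_graph (clique_graph (clique_graph G))"
  shows "convergent_graph G"
proof -
  let ?I = "\<lambda>n. iterated_clique_graph n G"
  have Hel: "Helly_graph (?I (2 + n))" for n
  proof (induction n)
    case 0 show ?case using iterated_2_Helly[OF G H] by simp
  next
    case (Suc n) show ?case using iterated_Helly_Suc[OF G Suc] by (simp only: add_Suc_right)
  qed
  \<comment> \<open>The size bound compares iterates two steps apart, hence the restriction to even
    indices.\<close>
  have bound: "card (pverts (?I (2 + 2 * n))) \<le> card (pverts (?I 2))" for n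
  proof (induction n)
    case (Suc n)
    have "card (pverts (?I (2 + 2 * Suc n))) \<le> card (pverts (?I (2 + 2 * n)))"
      using card_iterated_le[OF G Hel[of "2 * n"]] by simp
    then show ?case using Suc by linarith
  qed simp
  obtain m n where "m < n" "digraph_iso (with_proj (?I (2 + 2 * m))) (with_proj (?I (2 + 2 * n)))"
    by (rule bounded_order_iso[of "\<lambda>n. ?I (2 + 2 * n)", OF pair_graph_iterated[OF G] bound])
  moreover from this have "2 + 2 * m < 2 + 2 * n" by simp
  ultimately show ?thesis unfolding convergent_graph_def by blast
qed

section \<open>Recognising the octahedron\<close>

lemma neighbour_count_le:
  assumes G: "pair_graph G" and deg: "max_degree G \<le> k"
  shows "card {w. (v, w) \<in> parcs G} \<le> k"
proof (cases "v \<in> pverts G")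
  case True
  have "out_arcs (with_proj G) v = Pair v ` {w. (v, w) \<in> parcs G}"
    by (auto simp: out_arcs_def)
  then have "card {w. (v, w) \<in> parcs G} = out_degree (with_proj G) v"
    by (simp add: out_degree_def card_image inj_on_def)
  also have "\<dots> \<le> max_degree G"
    unfolding max_degree_def using pair_graphD(1)[OF G] True by (intro Max_ge) auto
  finally show ?thesis using deg by simp
next
  case False
  then have "{w. (v, w) \<in> parcs G} = {}" using pair_graphD(4)[OF G] by blast
  then show ?thesis by simp
qed

text \<open>By symmetry of the arcs, connectedness yields a directed path from \<open>a\<close> to
  every vertex, and such a path cannot leave \<open>W\<close>.\<close>

lemma connected_closed_set:
  assumes G: "pair_graph G" and con: "Digraph_Component.connected (with_proj G)"
    and W: "a \<in> W" "a \<in> pverts G" "\<And>u v. u \<in> W \<Longrightarrow> (u, v) \<in> parcs G \<Longrightarrow> v \<in> W"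
  shows "pverts G \<subseteq> W"
proof
  fix v assume v: "v \<in> pverts G"
  interpret pair_graph G by (rule G)
  have "a \<rightarrow>\<^sup>*\<^bsub>with_proj G\<^esub> v"
    using con v W(2) symmetric_connected_imp_strongly_connected[OF pair_sym_arcs] strongly_connectedE
    by (metis with_proj_simps(1))
  then show "v \<in> W"
    by (induction rule: reachable_induct) (use W(1,3) in auto)
qed

text \<open>Each of the six vertices already has four neighbours among them, so by the degree bound
  the set is closed under adjacency, and by connectedness it is the whole graph.\<close>

lemma octahedron_if_octahedral:
  assumes G: "pair_graph G" and con: "Digraph_Component.connected (with_proj G)"
    and deg: "max_degree G \<le> 4"
    and edges: "(a, b) \<in> parcs G" "(b, c) \<in> parcs G" "(a, c) \<in> parcs G" "(x, b) \<in> parcs G" "(x, c) \<in> parcs G"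
      "(y, a) \<in> parcs G" "(y, c) \<in> parcs G" "(z, a) \<in> parcs G" "(z, b) \<in> parcs G"
      "(x, y) \<in> parcs G" "(y, z) \<in> parcs G" "(x, z) \<in> parcs G"
    and opp: "x \<noteq> a" "y \<noteq> b" "z \<noteq> c"
  shows "digraph_iso (with_proj G) (with_proj octahedron)"
proof -
  note D = pair_graphD[OF G]
  have e: "(b, a) \<in> parcs G" "(c, b) \<in> parcs G" "(c, a) \<in> parcs G" "(b, x) \<in> parcs G" "(c, x) \<in> parcs G"
      "(a, y) \<in> parcs G" "(c, y) \<in> parcs G" "(a, z) \<in> parcs G" "(b, z) \<in> parcs G"
      "(y, x) \<in> parcs G" "(z, y) \<in> parcs G" "(z, x) \<in> parcs G"
    by (rule D(3), rule edges)+
  have ne: "u \<noteq> v" if "(u, v) \<in> parcs G" for u v using that D(6) by blast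
  have d: "distinct [a, b, c, x, y, z]"
    using edges[THEN ne] opp by auto
  have four: "(v, w) \<in> parcs G \<longleftrightarrow> w \<in> {p, q, r, s}"
    if "(v, p) \<in> parcs G" "(v, q) \<in> parcs G" "(v, r) \<in> parcs G" "(v, s) \<in> parcs G" "distinct [p, q, r, s]"
    for v w p q r s
  proof -
    have "finite {w. (v, w) \<in> parcs G}" by (rule finite_subset[OF _ D(1)]) (use D(5) in auto)
    moreover have "{p, q, r, s} \<subseteq> {w. (v, w) \<in> parcs G}" using that by auto
    moreover have "card {p, q, r, s} = 4" using that(5) by simp
    ultimately have "{p, q, r, s} = {w. (v, w) \<in> parcs G}"
      using card_seteq[of "{w. (v, w) \<in> parcs G}" "{p, q, r, s}"] neighbour_count_le[OF G deg, of v] by simp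
    then show ?thesis by blast
  qed
  have na: "(a, w) \<in> parcs G \<longleftrightarrow> w \<in> {b, c, y, z}" for w by (rule four) (use e edges d in auto)
  have nb: "(b, w) \<in> parcs G \<longleftrightarrow> w \<in> {a, c, x, z}" for w by (rule four) (use e edges d in auto)
  have nc: "(c, w) \<in> parcs G \<longleftrightarrow> w \<in> {a, b, x, y}" for w by (rule four) (use e edges d in auto)
  have nx: "(x, w) \<in> parcs G \<longleftrightarrow> w \<in> {b, c, y, z}" for w by (rule four) (use e edges d in auto)
  have ny: "(y, w) \<in> parcs G \<longleftrightarrow> w \<in> {a, c, x, z}" for w by (rule four) (use e edges d in auto)
  have nz: "(z, w) \<in> parcs G \<longleftrightarrow> w \<in> {a, b, x, y}" for w by (rule four) (use e edges d in auto)
  let ?W = "{a, b, c, x, y, z}"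
  have "pverts G \<subseteq> ?W"
  proof (rule connected_closed_set[OF G con, of a])
    fix u v assume "u \<in> ?W" "(u, v) \<in> parcs G"
    then show "v \<in> ?W" by (elim insertE emptyE) (simp_all add: na nb nc nx ny nz, auto)
  qed (use D(4)[OF edges(1)] in auto)
  moreover have "?W \<subseteq> pverts G" using D(4)[OF edges(1)] D(4)[OF edges(2)] D(5)[OF edges(2)] D(4)[OF edges(4)]
      D(4)[OF edges(6)] D(4)[OF edges(8)] by auto
  ultimately have V: "pverts G = ?W" by blast
  \<comment> \<open>The first coordinate names the antipodal pair (\<open>a\<close> and
    \<open>x\<close>, \<open>b\<close> and \<open>y\<close>, \<open>c\<close> and \<open>z\<close>),
    that is, the part of the tripartite graph; the second tells its two members apart. The last
    default is the label of \<open>z\<close>.\<close>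
  define f :: "'a \<Rightarrow> nat \<times> nat" where "f u = (if u = a then (0, 0) else if u = x then (0, 1) else
    if u = b then (1, 0) else if u = y then (1, 1) else if u = c then (2, 0) else (2, 1))" for u
  have f: "f a = (0, 0)" "f x = (0, 1)" "f b = (1, 0)" "f y = (1, 1)" "f c = (2, 0)" "f z = (2, 1)"
    using d by (auto simp: f_def)
  have inj: "inj_on f (pverts G)"
    unfolding V inj_on_def by (simp add: f)
  have fV: "f ` pverts G = {..<3} \<times> {..<2}"
    unfolding V by (auto simp: f lessThan_nat_numeral lessThan_Suc numeral_eq_Suc)
  have arcs: "(u, v) \<in> parcs G \<longleftrightarrow> fst (f u) \<noteq> fst (f v)" if "u \<in> ?W" "v \<in> ?W" for u v
    using that d by (elim insertE emptyE) (simp_all add: na nb nc nx ny nz f, auto)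
  have "map_prod f f ` parcs G = {(u, v). u \<in> f ` pverts G \<and> v \<in> f ` pverts G \<and> fst u \<noteq> fst v}"
  proof (intro subset_antisym subsetI)
    fix e assume "e \<in> map_prod f f ` parcs G"
    then obtain u v where "(u, v) \<in> parcs G" "e = (f u, f v)" by auto
    then show "e \<in> {(u, v). u \<in> f ` pverts G \<and> v \<in> f ` pverts G \<and> fst u \<noteq> fst v}"
      using arcs[of u v] D(4,5)[of u v] V by auto
  next
    fix e assume "e \<in> {(u, v). u \<in> f ` pverts G \<and> v \<in> f ` pverts G \<and> fst u \<noteq> fst v}"
    then obtain u v where uv: "e = (f u, f v)" "u \<in> pverts G" "v \<in> pverts G" "fst (f u) \<noteq> fst (f v)" by blast
    then have "(u, v) \<in> parcs G" using arcs[of u v] V by simp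
    then show "e \<in> map_prod f f ` parcs G" using uv(1) by force
  qed
  then have "relabel f G = octahedron"
    unfolding relabel_def octahedron_def fV by simp
  then show ?thesis using relabel_iso[OF D(2) inj] by simp
qed

theorem mainTheorem1:
  fixes G :: "'a pair_pre_digraph"
  assumes "pair_graph G"
    and "Digraph_Component.connected (with_proj G)"
    and "max_degree G \<le> 4"
    and "\<not> digraph_iso (with_proj G) (with_proj octahedron)"
  shows "convergent_graph G"
proof -
  note D = pair_graphD[OF assms(1)]
  interpret low_degree_graph "pverts G" "\<lambda>u v. (u, v) \<in> parcs G"
  proof
    show "finite (pverts G)" by (rule D(1))
    show "(u, v) \<in> parcs G \<Longrightarrow> u \<in> pverts G" for u v by (rule D(4))
    show "(u, v) \<in> parcs G \<Longrightarrow> (v, u) \<in> parcs G" for u v by (rule D(3))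
    show "(v, v) \<notin> parcs G" for v by (rule D(6))
    show "card {w. (v, w) \<in> parcs G} \<le> 4" for v by (rule neighbour_count_le[OF assms(1,3)])
  \<comment> \<open>The remaining condition is \<open>no_octahedron\<close>: a violation would make
    \<open>G\<close> isomorphic to the octahedron.\<close>
  qed (use octahedron_if_octahedral[OF assms(1-3)] assms(4) in blast)
  have "R = closed_adj G" by (simp add: fun_eq_iff R_def closed_adj_def)
  then have "Helly_graph (clique_graph (clique_graph G))"
    using clique_Helly_second_clique_graph assms(1)
    by (simp add: Helly_graph_clique_graph_iff[OF pair_graph_clique_graph] cliques_clique_graph cliques_eq_maxcl)
  then show ?thesis by (rule convergent_if_second_clique_graph_Helly[OF assms(1)])
qed

end
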